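(* The maximal edge-induced bipartite subgraphs of a graph $G$ can be listed (each exactly once) with $O(m^3)$ time delay.
   Context: $G$ is a simple undirected graph with $m$ edges (isolated vertices disregarded in the complexity analysis). An edge-induced bipartite subgraph is a set $F\subseteq E(G)$ such that the graph with edge set $F$ and vertex set the endpoints of $F$ is bipartite; it is maximal if no $F'\supsetneq F$ has this property. Delay is the maximum time before the first output, between consecutive outputs, and after the last output. *)

theory Defs
  imports Main
begin

section \<open>Simple graphs and maximal edge-induced bipartite subgraphs\<close>

definition simple_graph :: "'v set \<Rightarrow> 'v set set \<Rightarrow> bool" where
  "simple_graph V E \<longleftrightarrow> finite V \<and> (\<forall>e\<in>E. e \<subseteq> V \<and> card e = 2)"

definition bipartite :: "'v set \<Rightarrow> 'v set set \<Rightarrow> bool" where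
  "bipartite V E \<longleftrightarrow>
     (\<exists>A B. A \<inter> B = {} \<and> A \<union> B = V \<and> (\<forall>e\<in>E. \<exists>a\<in>A. \<exists>b\<in>B. e = {a, b}))"

text \<open>The subgraph induced by \<open>F\<close> has the endpoints of \<open>F\<close>, i.e. \<open>\<Union>F\<close>, as its vertex set.\<close>

definition edge_bipartite :: "'v set set \<Rightarrow> 'v set set \<Rightarrow> bool" where
  "edge_bipartite E F \<longleftrightarrow> F \<subseteq> E \<and> bipartite (\<Union>F) F"

definition maximal_edge_bipartite :: "'v set set \<Rightarrow> 'v set set \<Rightarrow> bool" where
  "maximal_edge_bipartite E F \<longleftrightarrow>
     edge_bipartite E F \<and> (\<forall>F'. F \<subset> F' \<longrightarrow> \<not> edge_bipartite E F')"


section \<open>Random access machine\<close>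

text \<open>
  Time is measured on a random access machine with write-only output, whose programs are
  structured.  A program mentions a fixed finite number of registers and of unbounded arrays, all
  holding natural numbers.  Every instruction and every evaluation of a branching or loop
  condition takes one time unit.  The only arithmetic is addition and truncated subtraction.
  The word length is not part of the semantics; it is restricted by \<open>word_bounded\<close> below.
\<close>

record state =
  reg :: "nat \<Rightarrow> nat"
  arr :: "nat \<Rightarrow> nat \<Rightarrow> nat"

datatype instr =
    Const nat nat
  | Move nat nat
  | Add nat nat nat
  | Sub nat nat nat
  | Load nat nat nat
  | Store nat nat nat
  | Write nat
  | EndSol

datatype test = Less nat nat | Equal nat nat

datatype com =
    Do instr
  | Seq com com
  | If test com com
  | While test com

text \<open>
  The visible effect of one time unit: nothing, writing one number to the output, or marking the
  current solution (the numbers written since the previous mark) as complete.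
\<close>

datatype event = Silent | Wrote nat | Completed

fun effect :: "instr \<Rightarrow> state \<Rightarrow> state" where
  "effect (Const r k) s = s\<lparr>reg := (reg s)(r := k)\<rparr>"
| "effect (Move r x) s = s\<lparr>reg := (reg s)(r := reg s x)\<rparr>"
| "effect (Add r x y) s = s\<lparr>reg := (reg s)(r := reg s x + reg s y)\<rparr>"
| "effect (Sub r x y) s = s\<lparr>reg := (reg s)(r := reg s x - reg s y)\<rparr>"
| "effect (Load r a x) s = s\<lparr>reg := (reg s)(r := arr s a (reg s x))\<rparr>"
| "effect (Store a x y) s = s\<lparr>arr := (arr s)(a := (arr s a)(reg s x := reg s y))\<rparr>"
| "effect (Write x) s = s"
| "effect EndSol s = s"

fun visible :: "instr \<Rightarrow> state \<Rightarrow> event" where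
  "visible (Write x) s = Wrote (reg s x)"
| "visible EndSol s = Completed"
| "visible _ s = Silent"

fun holds :: "test \<Rightarrow> state \<Rightarrow> bool" where
  "holds (Less x y) s \<longleftrightarrow> reg s x < reg s y"
| "holds (Equal x y) s \<longleftrightarrow> reg s x = reg s y"

text \<open>
  \<open>exec c s tr s'\<close>: started in \<open>s\<close>, program \<open>c\<close> halts in \<open>s'\<close>.  The trace \<open>tr\<close> has one entry per
  time unit, consisting of the event of that time unit and the state at its end, so
  \<open>length tr\<close> is the running time.
\<close>

type_synonym trace = "(event \<times> state) list"

inductive exec :: "com \<Rightarrow> state \<Rightarrow> trace \<Rightarrow> state \<Rightarrow> bool" where
  Do: "exec (Do i) s [(visible i s, effect i s)] (effect i s)"
| Seq: "exec c s tr s' \<Longrightarrow> exec d s' tr' s'' \<Longrightarrow> exec (Seq c d) s (tr @ tr') s''"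
| IfTrue: "holds b s \<Longrightarrow> exec c s tr s' \<Longrightarrow> exec (If b c d) s ((Silent, s) # tr) s'"
| IfFalse: "\<not> holds b s \<Longrightarrow> exec d s tr s' \<Longrightarrow> exec (If b c d) s ((Silent, s) # tr) s'"
| WhileFalse: "\<not> holds b s \<Longrightarrow> exec (While b c) s [(Silent, s)] s"
| WhileTrue: "holds b s \<Longrightarrow> exec c s tr s' \<Longrightarrow> exec (While b c) s' tr' s''
    \<Longrightarrow> exec (While b c) s ((Silent, s) # tr @ tr') s''"

inductive_cases exec_DoE: "exec (Do i) s tr s'"
inductive_cases exec_SeqE: "exec (Seq c d) s tr s'"
inductive_cases exec_IfE: "exec (If b c d) s tr s'"
inductive_cases exec_WhileE: "exec (While b c) s tr s'"

lemma exec_deterministic: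
  "exec c s tr s' \<Longrightarrow> exec c s tr2 s2 \<Longrightarrow> tr2 = tr \<and> s2 = s'"
proof (induction arbitrary: tr2 s2 rule: exec.induct)
  case Do
  then show ?case by (auto elim: exec_DoE)
next
  case Seq
  from Seq.prems show ?case by (rule exec_SeqE) (use Seq.IH in blast)
next
  case IfTrue
  from IfTrue.prems show ?case by (rule exec_IfE) (use IfTrue in blast)+
next
  case IfFalse
  from IfFalse.prems show ?case by (rule exec_IfE) (use IfFalse in blast)+
next
  case WhileFalse
  from WhileFalse.prems show ?case by (rule exec_WhileE) (use WhileFalse in blast)+
next
  case WhileTrue
  from WhileTrue.prems show ?case by (rule exec_WhileE) (use WhileTrue in blast)+
qed

text \<open>
  Words have \<open>O(log (N + t))\<close> bits at time \<open>t\<close>, where \<open>N\<close> measures the input: the values in memory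
  are bounded by a polynomial in \<open>N + t\<close>.  The dependence on \<open>t\<close> lets a program address all
  the memory it has had time to use, which may be exponential in the size of the input.
\<close>

definition word_bounded :: "nat \<Rightarrow> nat \<Rightarrow> nat \<Rightarrow> trace \<Rightarrow> bool" where
  "word_bounded c d N tr \<longleftrightarrow>
     (\<forall>t < length tr. let s = snd (tr ! t); B = c * (N + t + 1) ^ d in
        (\<forall>r. reg s r \<le> B) \<and> (\<forall>a i. arr s a i \<le> B))"


section \<open>Enumeration and delay\<close>

definition output_times :: "event list \<Rightarrow> nat list" where
  "output_times evs = map Suc (filter (\<lambda>t. evs ! t = Completed) [0..<length evs])"

text \<open>
  A solution counts as output once it is completely written.  Adding the start and the end of the
  run to the list of output times accounts for the time before the first and after the
  last output.
\<close>

definition delay :: "event list \<Rightarrow> nat" where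
  "delay evs = (let ts = 0 # output_times evs @ [length evs] in
     Max {ts ! Suc i - ts ! i | i. Suc i < length ts})"

text \<open>The output of the run consists precisely of the solutions \<open>xss\<close>, in this order.\<close>

definition writes_solutions :: "event list \<Rightarrow> nat list list \<Rightarrow> bool" where
  "writes_solutions evs xss \<longleftrightarrow>
     filter (\<lambda>e. e \<noteq> Silent) evs = concat (map (\<lambda>xs. map Wrote xs @ [Completed]) xss)"


section \<open>Graphs as input, edge sets as output\<close>

text \<open>
  The input graph on the vertices \<open>{0..<n}\<close> is an arbitrary enumeration of its edges, each as a
  pair of endpoints in arbitrary order.
\<close>

definition edge_of :: "nat \<times> nat \<Rightarrow> nat set" where
  "edge_of p = {fst p, snd p}"

definition represents :: "(nat \<times> nat) list \<Rightarrow> nat set set \<Rightarrow> bool" where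
  "represents ps E \<longleftrightarrow> distinct (map edge_of ps) \<and> set (map edge_of ps) = E"

text \<open>
  Registers 0 and 1 hold the number of edges and of vertices, arrays 0 and 1 the endpoints of
  the edges; all other memory is zero.
\<close>

definition input_state :: "nat \<Rightarrow> (nat \<times> nat) list \<Rightarrow> state" where
  "input_state n ps =
     \<lparr>reg = (\<lambda>_. 0)(0 := length ps, 1 := n),
      arr = (\<lambda>_ _. 0)(0 := (\<lambda>i. if i < length ps then fst (ps ! i) else 0),
                      1 := (\<lambda>i. if i < length ps then snd (ps ! i) else 0))\<rparr>"

text \<open>An edge set is written as a list of indices of edges in the input.\<close>

definition edges_at :: "(nat \<times> nat) list \<Rightarrow> nat list \<Rightarrow> nat set set" where
  "edges_at ps xs = (\<lambda>i. edge_of (ps ! i)) ` set xs"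

definition lists_exactly_once ::
  "(nat \<times> nat) list \<Rightarrow> nat list list \<Rightarrow> nat set set set \<Rightarrow> bool" where
  "lists_exactly_once ps xss \<F> \<longleftrightarrow>
     (\<forall>xs\<in>set xss. distinct xs \<and> set xs \<subseteq> {..<length ps}) \<and>
     distinct (map (edges_at ps) xss) \<and>
     set (map (edges_at ps) xss) = \<F>"

end

theory Submission
  imports Defs
begin

text \<open>
  A bipartite edge set is maximal iff adding any single edge creates an odd cycle.  Given a maximal
  set \<open>G\<close>, an edge \<open>e\<close> and an endpoint \<open>v\<close> of \<open>e\<close>, drop all edges of \<open>G\<close> at \<open>v\<close>, add \<open>e\<close>, and complete
  the result greedily to a maximal set, the neighbour of \<open>G\<close>; there are at most \<open>2 m\<close> neighbours.  For
  a target \<open>H\<close>, order the vertices so that each component of \<open>H\<close> is explored connectedly.  If \<open>G\<close> contains all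
  edges of \<open>H\<close> among the vertices seen so far, and \<open>v\<close> is the next one, attached by \<open>e \<in> H\<close>, then the
  neighbour for \<open>(e, v)\<close> also contains the edges of \<open>H\<close> at \<open>v\<close>, since a connected bipartite graph has only
  one 2-colouring up to exchanging the colours.  Hence every maximal set is reached from any other.

  The machine runs a breadth-first search of this graph of solutions and outputs a solution whenever one
  is taken from the queue.  Greedy completion keeps component labels and colours that are updated naively
  in time \<open>O(m)\<close> per edge, so a neighbour costs \<open>O(m\<^sup>2)\<close>; a binary trie of depth \<open>m\<close> detects
  repetitions in time \<open>O(m)\<close>.
\<close>

section \<open>Maximal bipartite edge sets\<close>

text \<open>Bipartiteness passes to subsets, so a single pass over all edges completes a set to a
  maximal one. The obstacle in the reachability argument is that the overlap of \<open>G\<close>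
  with the target \<open>H\<close> need not grow: edges of \<open>H\<close> between the new vertex
  and unseen vertices may be dropped and not come back. Progress is therefore measured by the
  vertices seen, and only the edges of \<open>H\<close> among these are kept under control. The
  delay is cubic because exactly one expansion separates two consecutive outputs, and it computes
  \<open>2 * m\<close> neighbours in quadratic time each; the last expansion accounts for the time
  after the last output. Queue and trie may grow exponentially, but they start on zeroed memory and
  only ever gain cells, so neither is initialised or cleared. The number of vertices is not bounded
  in terms of \<open>m\<close>, so no loop runs over the vertices; they are touched only as
  endpoints of edges.\<close>

text \<open>Edge sets are represented by sets of indices; edge \<open>i\<close> has the endpoints \<open>a i\<close> and \<open>b i\<close>.\<close>

definition proper :: "(nat \<Rightarrow> nat) \<Rightarrow> (nat \<Rightarrow> nat) \<Rightarrow> nat set \<Rightarrow> (nat \<Rightarrow> bool) \<Rightarrow> bool" where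
  "proper a b G c \<longleftrightarrow> (\<forall>i\<in>G. c (a i) \<noteq> c (b i))"

definition bip :: "(nat \<Rightarrow> nat) \<Rightarrow> (nat \<Rightarrow> nat) \<Rightarrow> nat set \<Rightarrow> bool" where
  "bip a b G \<longleftrightarrow> (\<exists>c. proper a b G c)"

definition maxbip :: "(nat \<Rightarrow> nat) \<Rightarrow> (nat \<Rightarrow> nat) \<Rightarrow> nat \<Rightarrow> nat set \<Rightarrow> bool" where
  "maxbip a b m G \<longleftrightarrow> G \<subseteq> {..<m} \<and> bip a b G \<and> (\<forall>i<m. i \<notin> G \<longrightarrow> \<not> bip a b (insert i G))"

section \<open>Greedy completion and neighbours\<close>

definition try_add :: "(nat \<Rightarrow> nat) \<Rightarrow> (nat \<Rightarrow> nat) \<Rightarrow> nat set \<Rightarrow> nat \<Rightarrow> nat set" where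
  "try_add a b G i = (if bip a b (insert i G) then insert i G else G)"

definition greedy :: "(nat \<Rightarrow> nat) \<Rightarrow> (nat \<Rightarrow> nat) \<Rightarrow> nat list \<Rightarrow> nat set" where
  "greedy a b xs = foldl (try_add a b) {} xs"

text \<open>The order carries the construction: \<open>e\<close> comes first and the survivors of
  \<open>G\<close> second, so later edges cannot displace them; offering every index at the end
  makes the outcome maximal. Repetitions do no harm, since a second offer changes nothing.\<close>

definition candidates ::
  "(nat \<Rightarrow> nat) \<Rightarrow> (nat \<Rightarrow> nat) \<Rightarrow> nat \<Rightarrow> nat set \<Rightarrow> nat \<Rightarrow> nat \<Rightarrow> nat list" where
  "candidates a b m G e v =
     e # filter (\<lambda>i. i \<in> G \<and> a i \<noteq> v \<and> b i \<noteq> v) [0..<m] @ [0..<m]"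

definition neighbour ::
  "(nat \<Rightarrow> nat) \<Rightarrow> (nat \<Rightarrow> nat) \<Rightarrow> nat \<Rightarrow> nat set \<Rightarrow> nat \<Rightarrow> nat \<Rightarrow> nat set" where
  "neighbour a b m G e v = greedy a b (candidates a b m G e v)"

lemma proper_mono: "proper a b G c \<Longrightarrow> H \<subseteq> G \<Longrightarrow> proper a b H c"
  by (auto simp: proper_def)

lemma bip_mono: "bip a b G \<Longrightarrow> H \<subseteq> G \<Longrightarrow> bip a b H"
  unfolding bip_def using proper_mono by blast

lemma bip_empty [simp]: "bip a b {}"
  by (simp add: bip_def proper_def)

lemma foldl_try_add_bip: "bip a b G \<Longrightarrow> bip a b (foldl (try_add a b) G xs)"
  by (induction xs arbitrary: G) (auto simp: try_add_def)

lemma foldl_try_add_increasing: "G \<subseteq> foldl (try_add a b) G xs"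
proof (induction xs arbitrary: G)
  case (Cons x xs)
  have "G \<subseteq> try_add a b G x" by (auto simp: try_add_def)
  with Cons show ?case by fastforce
qed simp

lemma foldl_try_add_subset: "foldl (try_add a b) G xs \<subseteq> G \<union> set xs"
proof (induction xs arbitrary: G)
  case (Cons x xs)
  have "try_add a b G x \<subseteq> insert x G" by (auto simp: try_add_def)
  with Cons[of "try_add a b G x"] show ?case by auto
qed simp

text \<open>An edge compatible with the final set is compatible with the smaller set it was tested
  against, so it was accepted then.\<close>

lemma foldl_try_add_saturated:
  "i \<in> set xs \<Longrightarrow> bip a b (insert i (foldl (try_add a b) G xs)) \<Longrightarrow> i \<in> foldl (try_add a b) G xs"
proof (induction xs arbitrary: G)
  case (Cons x xs)
  show ?case
  proof (cases "i \<in> set xs")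
    case True
    with Cons show ?thesis by simp
  next
    case False
    with Cons.prems have "x = i" by simp
    let ?H = "foldl (try_add a b) (try_add a b G x) xs"
    have sub: "try_add a b G x \<subseteq> ?H" by (rule foldl_try_add_increasing)
    have "G \<subseteq> ?H" using sub by (auto simp: try_add_def split: if_splits)
    then have "bip a b (insert i G)" using Cons.prems(2) by (auto intro: bip_mono)
    then have "i \<in> try_add a b G x" using \<open>x = i\<close> by (simp add: try_add_def)
    with sub show ?thesis by auto
  qed
qed simp

lemma greedy_maxbip:
  assumes "set xs = {..<m}"
  shows "maxbip a b m (greedy a b xs)"
  using assms foldl_try_add_bip[of a b "{}" xs] foldl_try_add_subset[of a b "{}" xs]
    foldl_try_add_saturated[of _ xs a b "{}"]
  unfolding maxbip_def greedy_def by auto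

lemma greedy_append: "greedy a b (xs @ ys) = foldl (try_add a b) (greedy a b xs) ys"
  by (simp add: greedy_def)

text \<open>While a bipartite prefix is being processed, every set under test is a subset of it, so
  no test fails.\<close>

lemma greedy_bip_prefix:
  assumes "bip a b (set xs)"
  shows "set xs \<subseteq> greedy a b (xs @ ys)"
proof -
  have "set xs \<subseteq> greedy a b xs"
  proof
    fix i assume i: "i \<in> set xs"
    have "greedy a b xs \<subseteq> set xs"
      using foldl_try_add_subset[of a b "{}" xs] by (simp add: greedy_def)
    then have "bip a b (insert i (greedy a b xs))"
      using i by (auto intro: bip_mono[OF assms])
    then show "i \<in> greedy a b xs"
      using foldl_try_add_saturated[OF i, of a b "{}"] by (simp add: greedy_def)
  qed
  also have "\<dots> \<subseteq> greedy a b (xs @ ys)"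
    by (simp add: greedy_append foldl_try_add_increasing)
  finally show ?thesis .
qed

lemma neighbour_maxbip: "e < m \<Longrightarrow> maxbip a b m (neighbour a b m G e v)"
  unfolding neighbour_def by (rule greedy_maxbip) (auto simp: candidates_def)

text \<open>Once its other edges are gone, the vertex \<open>v\<close> can be recoloured to fit the edge \<open>e\<close>.\<close>

lemma neighbour_superset:
  assumes G: "maxbip a b m G" and e: "v \<in> {a e, b e}" "a e \<noteq> b e"
  shows "insert e {i \<in> G. a i \<noteq> v \<and> b i \<noteq> v} \<subseteq> neighbour a b m G e v"
proof -
  let ?xs = "e # filter (\<lambda>i. i \<in> G \<and> a i \<noteq> v \<and> b i \<noteq> v) [0..<m]"
  obtain c where c: "proper a b G c" using G by (auto simp: maxbip_def bip_def)
  define u where "u = (if v = a e then b e else a e)"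
  have "proper a b (set ?xs) (c(v := \<not> c u))"
    using c e by (auto simp: proper_def u_def)
  then have "bip a b (set ?xs)" by (auto simp: bip_def)
  from greedy_bip_prefix[OF this, of "[0..<m]"] G show ?thesis
    by (auto simp: neighbour_def candidates_def maxbip_def)
qed

section \<open>Reachability of every maximal set\<close>

lemma maxbip_superset_eq:
  assumes "maxbip a b m H" "maxbip a b m G" "H \<subseteq> G"
  shows "H = G"
proof (rule ccontr)
  assume "H \<noteq> G"
  with assms obtain i where i: "i \<in> G" "i \<notin> H" by blast
  with assms have "bip a b (insert i H)" by (auto simp: maxbip_def intro: bip_mono[of a b G])
  with i assms show False by (auto simp: maxbip_def)
qed

text \<open>
  \<open>U\<close> is the union of the components of \<open>H\<close> that are already finished and \<open>C\<close> a connected part of the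
  component being explored; \<open>d\<close> is a fixed colouring of \<open>H\<close>.
\<close>

lemma closed_family_step:
  assumes fin: "finite V" "a ` H \<union> b ` H \<subseteq> V"
    and H: "maxbip a b m H" and d: "proper a b H d"
    and sols: "\<And>G. G \<in> \<G> \<Longrightarrow> maxbip a b m G"
    and closed: "\<And>G e v. G \<in> \<G> \<Longrightarrow> e < m \<Longrightarrow> v \<in> {a e, b e} \<Longrightarrow> neighbour a b m G e v \<in> \<G>"
  shows "G \<in> \<G> \<Longrightarrow> \<forall>i\<in>H. a i \<in> U \<longleftrightarrow> b i \<in> U \<Longrightarrow> U \<inter> C = {} \<Longrightarrow>
    {i \<in> H. a i \<in> U \<union> C \<and> b i \<in> U \<union> C} \<subseteq> G \<Longrightarrow>
    (\<And>c. proper a b {i \<in> H. a i \<in> C \<and> b i \<in> C} c \<Longrightarrow>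
      (\<forall>x\<in>C. c x = d x) \<or> (\<forall>x\<in>C. c x \<noteq> d x)) \<Longrightarrow> H \<in> \<G>"
\<comment> \<open>Each step either attaches one vertex to \<open>C\<close> or, when the component is
  exhausted, moves \<open>C\<close> into \<open>U\<close> and picks a new root. Both shrink the
  unseen part of \<open>V\<close>, even if \<open>G\<close> stays the same.\<close>
proof (induction "card (V - (U \<union> C))" arbitrary: G U C rule: less_induct)
  case less
  note G = less.prems(1) and U = less.prems(2) and UC = less.prems(3) and agree = less.prems(4)
    and conn = less.prems(5)
  have smaller: "card (V - insert w (U \<union> C)) < card (V - (U \<union> C))"
    if "w \<in> V" "w \<notin> U \<union> C" for w
    using fin that by (intro psubset_card_mono) auto
  show ?case
  proof (cases "\<exists>i\<in>H. a i \<in> C \<longleftrightarrow> b i \<notin> C")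
    case True
    then obtain i u w where i: "i \<in> H" "{a i, b i} = {u, w}" "u \<in> C" "w \<notin> C"
      by (metis insert_commute)
    have im: "i < m" using i H by (auto simp: maxbip_def)
    have w: "w \<in> V" "w \<notin> U" "w \<in> {a i, b i}"
      using i U UC fin by (auto simp: doubleton_eq_iff)
    have loop: "a j \<noteq> b j" if "j \<in> H" for j using d that by (auto simp: proper_def)
    define G' where "G' = neighbour a b m G i w"
    have G': "G' \<in> \<G>" unfolding G'_def using closed G im w by blast
    have sup: "insert i {i \<in> G. a i \<noteq> w \<and> b i \<noteq> w} \<subseteq> G'"
      unfolding G'_def using neighbour_superset[OF sols[OF G] w(3)] loop i by blast
    \<comment> \<open>The edge \<open>i\<close> forces opposite colours at \<open>u\<close> and
      \<open>w\<close> under both \<open>c\<close> and \<open>d\<close>, so agreement or opposition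
      at \<open>u\<close> carries over to \<open>w\<close>.\<close>
    have conn': "(\<forall>x\<in>insert w C. c x = d x) \<or> (\<forall>x\<in>insert w C. c x \<noteq> d x)"
      if c: "proper a b (insert i {i \<in> H. a i \<in> C \<and> b i \<in> C}) c" for c
    proof -
      have "c u \<noteq> c w" "d u \<noteq> d w"
        using c d i by (auto simp: proper_def doubleton_eq_iff)
      moreover have "proper a b {i \<in> H. a i \<in> C \<and> b i \<in> C} c" using c by (auto simp: proper_def)
      ultimately show ?thesis using conn[of c] \<open>u \<in> C\<close> by auto
    qed
    have agree': "{i \<in> H. a i \<in> U \<union> insert w C \<and> b i \<in> U \<union> insert w C} \<subseteq> G'"
    proof
      fix j assume j: "j \<in> {i \<in> H. a i \<in> U \<union> insert w C \<and> b i \<in> U \<union> insert w C}"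
      show "j \<in> G'"
      proof (cases "w \<in> {a j, b j}")
        case False
        then show ?thesis using j agree sup by auto
      next
        case True
        \<comment> \<open>An edge of \<open>H\<close> at \<open>w\<close> cannot end in
          \<open>U\<close>, since \<open>U\<close> is closed under the edges of \<open>H\<close> and
          \<open>w\<close> lies outside it.\<close>
        then have ends: "a j \<in> insert w C" "b j \<in> insert w C"
          using j U w UC by auto
        obtain c where c: "proper a b G' c" using sols[OF G'] by (auto simp: maxbip_def bip_def)
        \<comment> \<open>Nothing is known about which other edges at \<open>w\<close> the greedy
          pass took. But this connected part of \<open>H\<close> lies in \<open>G'\<close>, so the
          colouring \<open>c\<close> of \<open>G'\<close> is \<open>d\<close> or its complement on
          \<open>insert w C\<close>. Hence \<open>c\<close> also fits \<open>j\<close>, and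
          maximality of \<open>G'\<close> gives \<open>j \<in> G'\<close>.\<close>
        have "insert i {i \<in> H. a i \<in> C \<and> b i \<in> C} \<subseteq> G'"
          using sup agree \<open>w \<notin> C\<close> by auto
        note conn'[OF proper_mono[OF c this]]
        moreover have "d (a j) \<noteq> d (b j)" using d j by (simp add: proper_def)
        ultimately have "c (a j) \<noteq> c (b j)" using ends by blast
        then have "proper a b (insert j G') c" using c by (simp add: proper_def)
        then have "bip a b (insert j G')" unfolding bip_def by blast
        then show ?thesis using sols[OF G'] j H by (auto simp: maxbip_def)
      qed
    qed
    show ?thesis
    proof (rule less.hyps[of U "insert w C" G'])
      show "card (V - (U \<union> insert w C)) < card (V - (U \<union> C))"
        using smaller w i by simp
      show "(\<forall>x\<in>insert w C. c x = d x) \<or> (\<forall>x\<in>insert w C. c x \<noteq> d x)"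
        if "proper a b {i \<in> H. a i \<in> insert w C \<and> b i \<in> insert w C} c" for c
        using i by (intro conn' proper_mono[OF that]) (auto simp: doubleton_eq_iff)
    qed (use G' U UC w agree' in auto)
  next
    case False
    then have closed_UC: "a i \<in> U \<union> C \<longleftrightarrow> b i \<in> U \<union> C" if "i \<in> H" for i
      using that U by auto
    show ?thesis
    proof (cases "V \<subseteq> U \<union> C")
      case True
      then have "a i \<in> U \<union> C \<and> b i \<in> U \<union> C" if "i \<in> H" for i using fin(2) that by blast
      then have "H \<subseteq> G" using agree by blast
      then show ?thesis using maxbip_superset_eq H sols G by blast
    next
      case False
      then obtain r where r: "r \<in> V" "r \<notin> U \<union> C" by blast
      \<comment> \<open>A new root needs no new solution: an edge of \<open>H\<close> at
        \<open>r\<close> with both ends seen would either reach back into the closed set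
        \<open>U \<union> C\<close> or be a loop.\<close>
      have "{i \<in> H. a i \<in> U \<union> C \<union> {r} \<and> b i \<in> U \<union> C \<union> {r}} \<subseteq> G"
      proof
        fix i assume i: "i \<in> {i \<in> H. a i \<in> U \<union> C \<union> {r} \<and> b i \<in> U \<union> C \<union> {r}}"
        then have "a i \<noteq> b i" using d by (auto simp: proper_def)
        then show "i \<in> G" using i closed_UC[of i] r agree by auto
      qed
      then show ?thesis
        using smaller[of r] r G closed_UC by (intro less.hyps[of "U \<union> C" "{r}" G]) auto
    qed
  qed
qed

text \<open>With nothing seen yet, the hypotheses of the exploration hold vacuously, so any member
  of \<open>\<G>\<close> can serve as its start. In the search, \<open>\<G>\<close> consists of all
  queued solutions once the queue has run empty.\<close>

lemma closed_family_complete: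
  assumes sols: "\<And>G. G \<in> \<G> \<Longrightarrow> maxbip a b m G"
    and closed: "\<And>G e v. G \<in> \<G> \<Longrightarrow> e < m \<Longrightarrow> v \<in> {a e, b e} \<Longrightarrow> neighbour a b m G e v \<in> \<G>"
    and G: "G \<in> \<G>" and H: "maxbip a b m H"
  shows "H \<in> \<G>"
proof -
  obtain d where d: "proper a b H d" using H by (auto simp: maxbip_def bip_def)
  have "finite H" using H finite_subset by (fastforce simp: maxbip_def)
  then show ?thesis
    using closed_family_step[of "a ` H \<union> b ` H" a H b m d \<G> G "{}" "{}"] assms d by simp
qed

section \<open>From index sets back to edge sets\<close>

context
  fixes E :: "nat set set" and ps :: "(nat \<times> nat) list" and a b :: "nat \<Rightarrow> nat" and m :: nat
  assumes rep: "represents ps E"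
    and ab: "\<And>i. i < length ps \<Longrightarrow> a i = fst (ps ! i) \<and> b i = snd (ps ! i)"
    and m: "m = length ps"
begin

lemma edge_at: "i < m \<Longrightarrow> edge_of (ps ! i) = {a i, b i}"
  using ab m by (simp add: edge_of_def)

lemma edges_eq: "E = (\<lambda>i. edge_of (ps ! i)) ` {..<m}"
proof -
  have "E = edge_of ` set ps" using rep by (simp add: represents_def)
  also have "set ps = (!) ps ` {..<m}" using m by (auto simp: set_conv_nth)
  finally show ?thesis by (simp add: image_image)
qed

lemma inj_edge: "inj_on (\<lambda>i. edge_of (ps ! i)) {..<m}"
  using rep m by (auto simp: represents_def inj_on_def distinct_conv_nth)

lemma edge_bipartite_iff:
  assumes G: "G \<subseteq> {..<m}"
  shows "edge_bipartite E ((\<lambda>i. edge_of (ps ! i)) ` G) \<longleftrightarrow> bip a b G"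
proof -
  let ?F = "(\<lambda>i. edge_of (ps ! i)) ` G"
  have FE: "?F \<subseteq> E" using G edges_eq by auto
  show ?thesis
  proof
    assume "edge_bipartite E ?F"
    then obtain A B where AB: "A \<inter> B = {}" and e: "\<forall>e\<in>?F. \<exists>x\<in>A. \<exists>y\<in>B. e = {x, y}"
      unfolding edge_bipartite_def bipartite_def by metis
    have "proper a b G (\<lambda>x. x \<in> A)"
      unfolding proper_def
    proof
      fix i assume i: "i \<in> G"
      then obtain x y where "x \<in> A" "y \<in> B" "edge_of (ps ! i) = {x, y}" using e by blast
      then have "{a i, b i} = {x, y}" "x \<in> A" "y \<notin> A" using edge_at i G AB by auto
      then show "(a i \<in> A) \<noteq> (b i \<in> A)" by (auto simp: doubleton_eq_iff)
    qed
    then show "bip a b G" by (auto simp: bip_def)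
  next
    assume "bip a b G"
    then obtain c where c: "proper a b G c" by (auto simp: bip_def)
    \<comment> \<open>The bipartition has to cover exactly the endpoints of \<open>?F\<close>, so
      the colour classes are cut down to these.\<close>
    define A B where "A = {x \<in> \<Union>?F. c x}" and "B = {x \<in> \<Union>?F. \<not> c x}"
    have "\<exists>x\<in>A. \<exists>y\<in>B. e = {x, y}" if e: "e \<in> ?F" for e
    proof -
      obtain i where i: "i \<in> G" "e = {a i, b i}" using e edge_at G by auto
      have "a i \<in> \<Union>?F" "b i \<in> \<Union>?F" using i e by blast+
      moreover have "c (a i) \<noteq> c (b i)" using c i by (auto simp: proper_def)
      ultimately show ?thesis
        using i by (cases "c (a i)") (auto simp: A_def B_def insert_commute)
    qed
    moreover have "A \<inter> B = {}" "A \<union> B = \<Union>?F" by (auto simp: A_def B_def)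
    ultimately have "bipartite (\<Union>?F) ?F"
      unfolding bipartite_def by (intro exI[of _ A] exI[of _ B] conjI ballI)
    then show "edge_bipartite E ?F" using FE by (simp add: edge_bipartite_def)
  qed
qed

text \<open>By heredity, excluding all extensions by one edge excludes all larger sets. Injectivity
  of the indexing ensures that a new index is a new edge.\<close>

lemma maximal_edge_bipartite_sets:
  "{F. maximal_edge_bipartite E F} = (\<lambda>G. (\<lambda>i. edge_of (ps ! i)) ` G) ` {G. maxbip a b m G}"
proof -
  let ?e = "\<lambda>i. edge_of (ps ! i)"
  have *: "maximal_edge_bipartite E (?e ` G) \<longleftrightarrow> maxbip a b m G" if G: "G \<subseteq> {..<m}" for G
  proof
    assume max: "maximal_edge_bipartite E (?e ` G)"
    have "\<not> bip a b (insert i G)" if i: "i < m" "i \<notin> G" for i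
    proof -
      have "?e i \<notin> ?e ` G" using inj_edge i G by (auto simp: inj_on_def)
      then have "?e ` G \<subset> ?e ` insert i G" by auto
      with max have "\<not> edge_bipartite E (?e ` insert i G)"
        by (simp add: maximal_edge_bipartite_def del: image_insert)
      then show ?thesis using edge_bipartite_iff[of "insert i G"] i G by (simp del: image_insert)
    qed
    then show "maxbip a b m G"
      using max edge_bipartite_iff[OF G] G by (auto simp: maximal_edge_bipartite_def maxbip_def)
  next
    assume max: "maxbip a b m G"
    have "\<not> edge_bipartite E F'" if F': "?e ` G \<subset> F'" for F'
    proof
      assume bi: "edge_bipartite E F'"
      then have "F' \<subseteq> ?e ` {..<m}" using edges_eq by (simp add: edge_bipartite_def)
      then obtain G' where G': "G' \<subseteq> {..<m}" "F' = ?e ` G'" by (meson subset_imageE)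
      then have bip: "bip a b G'" using edge_bipartite_iff bi by simp
      have "G \<subseteq> G'"
        using F' G' G inj_edge unfolding inj_on_def by (smt (verit) image_iff psubsetD subset_iff)
      moreover obtain i where "i \<in> G'" "i \<notin> G" using F' G' by auto
      ultimately show False
        using max bip G' bip_mono[of a b G' "insert i G"] by (auto simp: maxbip_def)
    qed
    then show "maximal_edge_bipartite E (?e ` G)"
      using max edge_bipartite_iff[OF G] by (auto simp: maximal_edge_bipartite_def maxbip_def)
  qed
  show ?thesis
  proof (intro set_eqI iffI)
    fix F assume F: "F \<in> {F. maximal_edge_bipartite E F}"
    then have "F \<subseteq> ?e ` {..<m}"
      using edges_eq by (simp add: maximal_edge_bipartite_def edge_bipartite_def)
    then obtain G where "G \<subseteq> {..<m}" "F = ?e ` G" by (meson subset_imageE)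
    then show "F \<in> (\<lambda>G. ?e ` G) ` {G. maxbip a b m G}" using F * by auto
  next
    fix F assume "F \<in> (\<lambda>G. ?e ` G) ` {G. maxbip a b m G}"
    then show "F \<in> {F. maximal_edge_bipartite E F}" using * by (auto simp: maxbip_def)
  qed
qed

end

section \<open>Reasoning about silent programs\<close>

abbreviation seq :: "com \<Rightarrow> com \<Rightarrow> com" (infixr ";;" 60) where
  "c ;; d \<equiv> Seq c d"

fun target :: "instr \<Rightarrow> nat set" where
  "target (Const r _) = {r}"
| "target (Move r _) = {r}"
| "target (Add r _ _) = {r}"
| "target (Sub r _ _) = {r}"
| "target (Load r _ _) = {r}"
| "target _ = {}"

fun array_target :: "instr \<Rightarrow> nat set" where
  "array_target (Store a _ _) = {a}"
| "array_target _ = {}"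

fun wregs :: "com \<Rightarrow> nat set" where
  "wregs (Do i) = target i"
| "wregs (c ;; d) = wregs c \<union> wregs d"
| "wregs (If _ c d) = wregs c \<union> wregs d"
| "wregs (While _ c) = wregs c"

fun warrs :: "com \<Rightarrow> nat set" where
  "warrs (Do i) = array_target i"
| "warrs (c ;; d) = warrs c \<union> warrs d"
| "warrs (If _ c d) = warrs c \<union> warrs d"
| "warrs (While _ c) = warrs c"

text \<open>The frame condition: specifications describe only what changes, and the syntactic write
  sets take care of the rest.\<close>

definition same_outside :: "nat set \<Rightarrow> nat set \<Rightarrow> state \<Rightarrow> state \<Rightarrow> bool" where
  "same_outside R A s s' \<longleftrightarrow>
     (\<forall>r. r \<notin> R \<longrightarrow> reg s' r = reg s r) \<and> (\<forall>a. a \<notin> A \<longrightarrow> arr s' a = arr s a)"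

lemma effect_reg: "r \<notin> target i \<Longrightarrow> reg (effect i s) r = reg s r"
  by (cases i) auto

lemma effect_arr: "a \<notin> array_target i \<Longrightarrow> arr (effect i s) a = arr s a"
  by (cases i) auto

lemma exec_same_outside: "exec c s tr s' \<Longrightarrow> same_outside (wregs c) (warrs c) s s'"
  by (induction rule: exec.induct) (auto simp: same_outside_def effect_reg effect_arr)

text \<open>A weakest precondition for silent termination that hands the running time to
  \<open>Q\<close>. With the state as last argument, the rules for straight-line code are
  equivalences that the simplifier can execute symbolically.\<close>

definition quiet :: "com \<Rightarrow> (nat \<Rightarrow> state \<Rightarrow> bool) \<Rightarrow> state \<Rightarrow> bool" where
  "quiet c Q s \<longleftrightarrow>
     (\<exists>tr s'. exec c s tr s' \<and> (\<forall>x\<in>set tr. fst x = Silent) \<and> Q (length tr) s')"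

lemma quietI:
  "exec c s tr s' \<Longrightarrow> (\<And>x. x \<in> set tr \<Longrightarrow> fst x = Silent) \<Longrightarrow> Q (length tr) s' \<Longrightarrow> quiet c Q s"
  unfolding quiet_def by blast

lemma quiet_mono: "quiet c Q s \<Longrightarrow> (\<And>t s'. Q t s' \<Longrightarrow> R t s') \<Longrightarrow> quiet c R s"
  unfolding quiet_def by blast

lemma quiet_frame:
  assumes "quiet c Q s"
    and "\<And>t s'. Q t s' \<Longrightarrow> same_outside (wregs c) (warrs c) s s' \<Longrightarrow> R t s'"
  shows "quiet c R s"
  using assms exec_same_outside unfolding quiet_def by blast

lemma quiet_Do [simp]: "quiet (Do i) Q s \<longleftrightarrow> visible i s = Silent \<and> Q 1 (effect i s)"
  unfolding quiet_def by (auto elim!: exec_DoE intro!: exI exec.Do)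

lemma quiet_Seq [simp]:
  "quiet (c ;; d) Q s \<longleftrightarrow> quiet c (\<lambda>t s'. quiet d (\<lambda>t' s''. Q (t + t') s'') s') s"
proof
  assume "quiet (c ;; d) Q s"
  then show "quiet c (\<lambda>t s'. quiet d (\<lambda>t' s''. Q (t + t') s'') s') s"
    unfolding quiet_def by (fastforce elim!: exec_SeqE)
next
  assume "quiet c (\<lambda>t s'. quiet d (\<lambda>t' s''. Q (t + t') s'') s') s"
  then obtain tr s' tr' s'' where *: "exec c s tr s'" "\<forall>x\<in>set tr. fst x = Silent"
    "exec d s' tr' s''" "\<forall>x\<in>set tr'. fst x = Silent" "Q (length tr + length tr') s''"
    unfolding quiet_def by blast
  from exec.Seq[OF *(1,3)] show "quiet (c ;; d) Q s" by (rule quietI) (use * in auto)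
qed

lemma quiet_If [simp]:
  "quiet (If b c d) Q s \<longleftrightarrow>
     (if holds b s then quiet c (\<lambda>t s'. Q (Suc t) s') s else quiet d (\<lambda>t s'. Q (Suc t) s') s)"
proof
  assume "quiet (If b c d) Q s"
  then show "if holds b s then quiet c (\<lambda>t s'. Q (Suc t) s') s else quiet d (\<lambda>t s'. Q (Suc t) s') s"
    unfolding quiet_def by (fastforce elim!: exec_IfE)
next
  assume *: "if holds b s then quiet c (\<lambda>t s'. Q (Suc t) s') s
    else quiet d (\<lambda>t s'. Q (Suc t) s') s"
  show "quiet (If b c d) Q s"
  proof (cases "holds b s")
    case True
    with * obtain tr s' where **: "exec c s tr s'" "\<forall>x\<in>set tr. fst x = Silent" "Q (Suc (length tr)) s'"
      unfolding quiet_def by auto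
    from exec.IfTrue[OF True **(1)] show ?thesis by (rule quietI) (use ** in auto)
  next
    case False
    with * obtain tr s' where **: "exec d s tr s'" "\<forall>x\<in>set tr. fst x = Silent" "Q (Suc (length tr)) s'"
      unfolding quiet_def by auto
    from exec.IfFalse[OF False **(1)] show ?thesis by (rule quietI) (use ** in auto)
  qed
qed

lemma quiet_WhileFalse: "\<not> holds b s \<Longrightarrow> Q 1 s \<Longrightarrow> quiet (While b c) Q s"
  by (rule quietI, erule exec.WhileFalse) auto

lemma quiet_WhileTrue:
  assumes "holds b s" "quiet c (\<lambda>t s'. quiet (While b c) (\<lambda>t' s''. Q (Suc (t + t')) s'') s') s"
  shows "quiet (While b c) Q s"
proof -
  obtain tr s' tr' s'' where *: "exec c s tr s'" "\<forall>x\<in>set tr. fst x = Silent"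
    "exec (While b c) s' tr' s''" "\<forall>x\<in>set tr'. fst x = Silent"
    "Q (Suc (length tr + length tr')) s''"
    using assms(2) unfolding quiet_def by blast
  from exec.WhileTrue[OF assms(1) *(1,3)] show ?thesis by (rule quietI) (use * in auto)
qed

text \<open>Register 2 holds the constant 1 throughout.\<close>

definition For :: "nat \<Rightarrow> nat \<Rightarrow> com \<Rightarrow> com" where
  "For i n c = Do (Const i 0) ;; While (Less i n) (c ;; Do (Add i i 2))"

lemma wregs_For [simp]: "wregs (For i n c) = insert i (wregs c)"
  by (auto simp: For_def)

lemma warrs_For [simp]: "warrs (For i n c) = warrs c"
  by (auto simp: For_def)

text \<open>Besides the body, a round pays for the test and the increment, hence
  \<open>T + 2\<close>; the initialisation and the failing last test give the final 2. The invariant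
  is demanded with the counter already advanced, so its users never see the increment.\<close>

lemma quiet_For:
  assumes init: "I 0 (s\<lparr>reg := (reg s)(i := 0)\<rparr>)"
    and regs: "reg s 2 = 1" "n \<notin> R" "2 \<notin> R" "i \<notin> wregs c"
    and writes: "insert i (wregs c) \<subseteq> R" "warrs c \<subseteq> A"
    and step: "\<And>k s'. k < reg s n \<Longrightarrow> I k s' \<Longrightarrow> reg s' i = k \<Longrightarrow>
      same_outside R A s s' \<Longrightarrow>
      quiet c (\<lambda>t s''. t \<le> T \<and> I (Suc k) (s''\<lparr>reg := (reg s'')(i := Suc k)\<rparr>)) s'"
    and post: "\<And>t s'. t \<le> reg s n * (T + 2) + 2 \<Longrightarrow> I (reg s n) s' \<Longrightarrow> reg s' i = reg s n \<Longrightarrow>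
      same_outside R A s s' \<Longrightarrow> Q t s'"
  shows "quiet (For i n c) Q s"
proof -
  let ?loop = "While (Less i n) (c ;; Do (Add i i 2))"
  let ?same = "same_outside R A s"
  have loop: "quiet ?loop (\<lambda>t s''. t \<le> (reg s n - k) * (T + 2) + 1 \<and>
      I (reg s n) s'' \<and> reg s'' i = reg s n \<and> ?same s'') s'"
    if "k \<le> reg s n" "I k s'" "reg s' i = k" "?same s'" for k s'
    using that
  proof (induction "reg s n - k" arbitrary: k s')
    case 0
    then have "reg s' n = reg s n" using regs by (auto simp: same_outside_def)
    with 0 show ?case by (intro quiet_WhileFalse) auto
  next
    case (Suc d)
    have k: "k < reg s n" using Suc.hyps by linarith
    have n: "reg s' n = reg s n" using Suc.prems regs by (auto simp: same_outside_def)
    have d: "reg s n - k = Suc (reg s n - Suc k)" using k by simp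
    let ?Q = "\<lambda>t s''. t \<le> (reg s n - Suc k) * (T + 2) + 1 \<and>
      I (reg s n) s'' \<and> reg s'' i = reg s n \<and> ?same s''"
    have next_iter: "quiet ?loop ?Q (s''\<lparr>reg := (reg s'')(i := Suc k)\<rparr>)"
      if "I (Suc k) (s''\<lparr>reg := (reg s'')(i := Suc k)\<rparr>)"
        "same_outside (wregs c) (warrs c) s' s''" for s''
      using Suc.hyps k Suc.prems that writes
      by (intro Suc.hyps(1)) (auto simp: same_outside_def subset_iff)
    have body: "quiet c (\<lambda>t s''. t \<le> T \<and> quiet ?loop ?Q (s''\<lparr>reg := (reg s'')(i := Suc k)\<rparr>) \<and>
        reg s'' i = k \<and> reg s'' 2 = 1) s'"
      by (rule quiet_frame[OF step[OF k Suc.prems(2-4)]])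
        (use next_iter Suc.prems regs writes in \<open>auto simp: same_outside_def\<close>)
    show ?case
    proof (rule quiet_WhileTrue)
      show "holds (Less i n) s'" using n k Suc.prems by simp
      show "quiet (c ;; Do (Add i i 2)) (\<lambda>t s'a. quiet ?loop
         (\<lambda>t' s''. Suc (t + t') \<le> (reg s n - k) * (T + 2) + 1 \<and>
           I (reg s n) s'' \<and> reg s'' i = reg s n \<and> ?same s'') s'a) s'"
        unfolding d by (auto intro!: quiet_mono[OF body] elim!: quiet_mono)
    qed
  qed
  have "quiet ?loop (\<lambda>t s'. Q (1 + t) s') (s\<lparr>reg := (reg s)(i := 0)\<rparr>)"
    by (rule quiet_mono[OF loop[of 0]]) (use init post writes in \<open>auto simp: same_outside_def\<close>)
  then show ?thesis by (simp add: For_def)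
qed

section \<open>Word size\<close>

text \<open>
  Additions only add the number of edges (register 0) or 1 (register 2), so the contents of the
  memory grow at most linearly with time.
\<close>

fun tame_instr :: "instr \<Rightarrow> bool" where
  "tame_instr (Const r k) \<longleftrightarrow> r \<noteq> 0 \<and> k \<le> 1"
| "tame_instr (Move r x) \<longleftrightarrow> r \<noteq> 0 \<and> r \<noteq> 2"
| "tame_instr (Add r x y) \<longleftrightarrow> r \<noteq> 0 \<and> r \<noteq> 2 \<and> (y = 0 \<or> y = 2)"
| "tame_instr (Sub r x y) \<longleftrightarrow> r \<noteq> 0 \<and> r \<noteq> 2"
| "tame_instr (Load r a x) \<longleftrightarrow> r \<noteq> 0 \<and> r \<noteq> 2"
| "tame_instr _ \<longleftrightarrow> True"

fun tame :: "com \<Rightarrow> bool" where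
  "tame (Do i) \<longleftrightarrow> tame_instr i"
| "tame (c ;; d) \<longleftrightarrow> tame c \<and> tame d"
| "tame (If _ c d) \<longleftrightarrow> tame c \<and> tame d"
| "tame (While _ c) \<longleftrightarrow> tame c"

definition bounded_state :: "nat \<Rightarrow> nat \<Rightarrow> state \<Rightarrow> bool" where
  "bounded_state m B s \<longleftrightarrow>
     reg s 0 \<le> m \<and> reg s 2 \<le> 1 \<and> (\<forall>r. reg s r \<le> B) \<and> (\<forall>a i. arr s a i \<le> B)"

lemma bounded_state_mono: "bounded_state m B s \<Longrightarrow> B \<le> B' \<Longrightarrow> bounded_state m B' s"
  unfolding bounded_state_def using le_trans by blast

text \<open>The second summand of an addition is at most \<open>m\<close> or at most 1, and
  constants are at most 1, so \<open>m + 1\<close> covers every instruction, even from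
  \<open>B = 0\<close>.\<close>

lemma effect_bounded:
  assumes "tame_instr i" "bounded_state m B s"
  shows "bounded_state m (B + (m + 1)) (effect i s)"
proof -
  define D where "D = B + (m + 1)"
  have B: "reg s r \<le> B" "arr s a j \<le> B" for r a j using assms(2) by (auto simp: bounded_state_def)
  have m: "reg s 0 \<le> m" "reg s 2 \<le> 1" using assms(2) by (auto simp: bounded_state_def)
  have D: "reg s r \<le> D" "arr s a j \<le> D" "reg s r - reg s r' \<le> D" "1 \<le> D"
    "reg s r + reg s 0 \<le> D" "reg s r + reg s 2 \<le> D" for r r' a j
    using B(1)[of r] B(2)[of a j] m by (auto simp: D_def)
  have "bounded_state m D (effect i s)"
    using assms(1) m D by (cases i) (auto simp: bounded_state_def intro: order_trans[of _ 1 D])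
  then show ?thesis by (simp add: D_def)
qed

fun bounded_trace :: "nat \<Rightarrow> nat \<Rightarrow> trace \<Rightarrow> bool" where
  "bounded_trace m B [] \<longleftrightarrow> True"
| "bounded_trace m B (x # tr) \<longleftrightarrow>
     bounded_state m (B + (m + 1)) (snd x) \<and> bounded_trace m (B + (m + 1)) tr"

lemma bounded_trace_append:
  "bounded_trace m B (xs @ ys) \<longleftrightarrow>
     bounded_trace m B xs \<and> bounded_trace m (B + length xs * (m + 1)) ys"
  by (induction xs arbitrary: B) (auto simp: algebra_simps)

lemma bounded_trace_nth:
  "bounded_trace m B tr \<Longrightarrow> t < length tr \<Longrightarrow> bounded_state m (B + Suc t * (m + 1)) (snd (tr ! t))"
proof (induction tr arbitrary: B t)
  case (Cons x tr)
  then show ?case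
    using Cons.IH[of "B + (m + 1)" "t - 1"] by (cases t) (auto simp: algebra_simps)
qed simp

lemma exec_bounded:
  "exec c s tr s' \<Longrightarrow> tame c \<Longrightarrow> bounded_state m B s \<Longrightarrow>
     bounded_trace m B tr \<and> bounded_state m (B + length tr * (m + 1)) s'"
proof (induction arbitrary: B rule: exec.induct)
  case (Do i s)
  then show ?case using effect_bounded[of i m B s] by simp
next
  case (Seq c s tr s' d tr' s'')
  then have "bounded_state m (B + length tr * (m + 1)) s'" by simp
  from Seq.IH(1)[OF _ Seq.prems(2)] Seq.IH(2)[OF _ this] Seq.prems show ?case
    by (simp add: bounded_trace_append algebra_simps)
next
  case (IfTrue b s c tr s' d)
  have s: "bounded_state m (B + (m + 1)) s"
    using IfTrue.prems(2) by (rule bounded_state_mono) simp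
  from IfTrue.IH[OF _ s] IfTrue.prems s show ?case by (simp add: algebra_simps)
next
  case (IfFalse b s d tr s' c)
  have s: "bounded_state m (B + (m + 1)) s"
    using IfFalse.prems(2) by (rule bounded_state_mono) simp
  from IfFalse.IH[OF _ s] IfFalse.prems s show ?case by (simp add: algebra_simps)
next
  case (WhileFalse b s c)
  have "bounded_state m (B + (m + 1)) s"
    using WhileFalse.prems(2) by (rule bounded_state_mono) simp
  then show ?case by simp
next
  case (WhileTrue b s c tr s' tr' s'')
  have s: "bounded_state m (B + (m + 1)) s"
    using WhileTrue.prems(2) by (rule bounded_state_mono) simp
  have 1: "bounded_trace m (B + (m + 1)) tr"
    "bounded_state m (B + (m + 1) + length tr * (m + 1)) s'"
    using WhileTrue.IH(1)[OF _ s] WhileTrue.prems by auto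
  from WhileTrue.IH(2)[OF _ 1(2)] WhileTrue.prems 1 s show ?case
    by (simp add: bounded_trace_append algebra_simps)
qed

lemma tame_word_bounded:
  assumes "exec c s tr s'" "tame c" "bounded_state m (m + n) s"
  shows "word_bounded 1 2 (n + m) tr"
  unfolding word_bounded_def Let_def
proof (intro allI impI)
  fix t assume t: "t < length tr"
  let ?B = "m + n + Suc t * (m + 1)"
  have bs: "bounded_state m ?B (snd (tr ! t))" using exec_bounded[OF assms] t bounded_trace_nth by blast
  \<comment> \<open>The exponent 2 stems from the product of the elapsed time and
    \<open>m + 1\<close>.\<close>
  have "?B \<le> 1 * (n + m + t + 1) ^ 2"
    by (simp add: power2_eq_square algebra_simps)
  then show "(\<forall>r. reg (snd (tr ! t)) r \<le> 1 * (n + m + t + 1) ^ 2) \<and>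
    (\<forall>a i. arr (snd (tr ! t)) a i \<le> 1 * (n + m + t + 1) ^ 2)"
    using bs unfolding bounded_state_def by (meson le_trans)
qed

section \<open>The enumeration program\<close>

abbreviation (input) "rM \<equiv> 0 :: nat"
abbreviation (input) "rOne \<equiv> 2 :: nat"
abbreviation (input) "rZero \<equiv> 3 :: nat"
abbreviation (input) "rHead \<equiv> 4 :: nat"
abbreviation (input) "rTail \<equiv> 5 :: nat"
abbreviation (input) "rHeadPtr \<equiv> 6 :: nat"
abbreviation (input) "rTailPtr \<equiv> 7 :: nat"
abbreviation (input) "rNodes \<equiv> 8 :: nat"
abbreviation (input) "rE \<equiv> 9 :: nat"
abbreviation (input) "rV \<equiv> 10 :: nat"
abbreviation (input) "rI \<equiv> 11 :: nat"
abbreviation (input) "rPtr \<equiv> 12 :: nat"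
abbreviation (input) "rLen \<equiv> 13 :: nat"
abbreviation (input) "rJ \<equiv> 14 :: nat"
abbreviation (input) "rK \<equiv> 15 :: nat"
abbreviation (input) "rX \<equiv> 16 :: nat"
abbreviation (input) "rLu \<equiv> 17 :: nat"
abbreviation (input) "rLw \<equiv> 18 :: nat"
abbreviation (input) "rCu \<equiv> 19 :: nat"
abbreviation (input) "rCw \<equiv> 20 :: nat"
abbreviation (input) "rS \<equiv> 21 :: nat"
abbreviation (input) "rT \<equiv> 22 :: nat"
abbreviation (input) "rNew \<equiv> 23 :: nat"
abbreviation (input) "rNode \<equiv> 24 :: nat"
abbreviation (input) "rBit \<equiv> 25 :: nat"
abbreviation (input) "rJunk \<equiv> 26 :: nat"

abbreviation (input) "aLabel \<equiv> 2 :: nat"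
abbreviation (input) "aColour \<equiv> 3 :: nat"
abbreviation (input) "aCand \<equiv> 4 :: nat"
abbreviation (input) "aSol \<equiv> 5 :: nat"
abbreviation (input) "aQueue \<equiv> 6 :: nat"
abbreviation (input) "aOne \<equiv> 7 :: nat"
abbreviation (input) "aZero \<equiv> 8 :: nat"

text \<open>There is no instruction without effect; writing to a register that is never read takes
  its place and costs one unit.\<close>

definition skip :: com where
  "skip = Do (Const rJunk 0)"

definition append_cand :: com where
  "append_cand = Do (Store aCand rLen rI) ;; Do (Add rLen rLen rOne)"

definition append_all :: com where
  "append_all = For rI rM append_cand"

text \<open>Solutions lie in the queue as consecutive blocks of \<open>m\<close> bits. As the
  machine cannot multiply, a block is read through a pointer that advances together with the edge
  index.\<close>

definition start_cands :: com where
  "start_cands = Do (Store aCand rZero rE) ;; Do (Move rLen rOne) ;; Do (Move rPtr rHeadPtr) ;;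
    For rI rM
     (Do (Load rS aQueue rPtr) ;;
      If (Equal rS rOne)
       (Do (Load rS 0 rI) ;;
        If (Equal rS rV) skip
         (Do (Load rS 1 rI) ;; If (Equal rS rV) skip append_cand))
       skip ;;
      Do (Add rPtr rPtr rOne))"

definition init_vertex :: "nat \<Rightarrow> com" where
  "init_vertex x = Do (Load rX x rI) ;; Do (Store aLabel rX rX) ;; Do (Store aColour rX rZero)"

definition init_labels :: com where
  "init_labels = For rI rM (init_vertex 0 ;; init_vertex 1 ;; Do (Store aSol rI rZero))"

definition relabel_vertex :: "nat \<Rightarrow> com" where
  "relabel_vertex x = Do (Load rX x rK) ;; Do (Load rS aLabel rX) ;;
     If (Equal rS rLu)
      (Do (Store aLabel rX rLw) ;;
       If (Equal rCu rCw)
        (Do (Load rT aColour rX) ;; Do (Sub rT rOne rT) ;; Do (Store aColour rX rT))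
        skip)
      skip"

definition relabel :: com where
  "relabel = For rK rM (relabel_vertex 0 ;; relabel_vertex 1)"

text \<open>Within a component, equal colours of the endpoints mean an odd cycle. Between two
  components the edge is always admissible; the component of its first endpoint is then absorbed,
  with colours flipped if both endpoints had the same one.\<close>

definition add_edge :: com where
  "add_edge =
     Do (Load rS 0 rI) ;; Do (Load rT 1 rI) ;;
     Do (Load rLu aLabel rS) ;; Do (Load rCu aColour rS) ;;
     Do (Load rLw aLabel rT) ;; Do (Load rCw aColour rT) ;;
     If (Equal rLu rLw)
      (If (Equal rCu rCw) skip (Do (Store aSol rI rOne)))
      (Do (Store aSol rI rOne) ;; relabel)"

definition run_greedy :: com where
  "run_greedy = init_labels ;; For rJ rLen (Do (Load rI aCand rJ) ;; add_edge)"

text \<open>\<open>rNew\<close> is overwritten on every level, so its final value tells whether the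
  last node on the path, the one for the whole word, was created.\<close>

definition trie_insert :: com where
  "trie_insert = Do (Const rNode 0) ;; Do (Const rNew 0) ;;
     For rI rM
      (Do (Load rBit aSol rI) ;;
       If (Equal rBit rOne) (Do (Load rS aOne rNode)) (Do (Load rS aZero rNode)) ;;
       If (Equal rS rZero)
        (Do (Move rS rNodes) ;; Do (Add rNodes rNodes rOne) ;;
         If (Equal rBit rOne) (Do (Store aOne rNode rS)) (Do (Store aZero rNode rS)) ;;
         Do (Const rNew 1))
        (Do (Const rNew 0)) ;;
       Do (Move rNode rS))"

definition enqueue :: com where
  "enqueue = For rI rM
      (Do (Load rS aSol rI) ;; Do (Store aQueue rTailPtr rS) ;; Do (Add rTailPtr rTailPtr rOne)) ;;
    Do (Add rTail rTail rOne)"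

definition process :: com where
  "process = start_cands ;; append_all ;; run_greedy ;; trie_insert ;;
     If (Equal rNew rOne) enqueue skip"

definition process_all :: com where
  "process_all = For rE rM
     (Do (Load rV 0 rE) ;; process ;; Do (Load rV 1 rE) ;; process)"

definition output_sol :: com where
  "output_sol = Do (Move rPtr rHeadPtr) ;;
     For rI rM
      (Do (Load rS aQueue rPtr) ;; If (Equal rS rOne) (Do (Write rI)) skip ;;
       Do (Add rPtr rPtr rOne)) ;;
     Do EndSol"

definition main_loop :: com where
  "main_loop = While (Less rHead rTail)
     (output_sol ;; process_all ;; Do (Add rHeadPtr rHeadPtr rM) ;; Do (Add rHead rHead rOne))"

text \<open>The first solution is enqueued without consulting \<open>rNew\<close>: for
  \<open>m = 0\<close> the root is already the node of the whole word, and the flag would be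
  0.\<close>

definition program :: com where
  "program = (Do (Const rOne 1) ;; Do (Const rNodes 1) ;; append_all ;; run_greedy ;;
     trie_insert ;; enqueue) ;; main_loop"

lemmas code_defs = skip_def append_cand_def append_all_def start_cands_def init_vertex_def
  init_labels_def relabel_vertex_def relabel_def add_edge_def run_greedy_def trie_insert_def
  enqueue_def process_def process_all_def

lemma tame_program: "tame program"
  by (simp add: program_def main_loop_def output_sol_def code_defs For_def)

section \<open>Candidate lists in memory\<close>

definition input_ok :: "(nat \<Rightarrow> nat) \<Rightarrow> (nat \<Rightarrow> nat) \<Rightarrow> nat \<Rightarrow> state \<Rightarrow> bool" where
  "input_ok a b m s \<longleftrightarrow>
     reg s rM = m \<and> reg s rOne = 1 \<and> reg s rZero = 0 \<and> arr s 0 = a \<and> arr s 1 = b"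

definition cands :: "state \<Rightarrow> nat list" where
  "cands s = map (arr s aCand) [0..<reg s rLen]"

lemma quiet_append_all:
  assumes "input_ok a b m s"
    and "\<And>t s'. t \<le> 4 * m + 2 \<Longrightarrow> cands s' = cands s @ [0..<m] \<Longrightarrow>
      same_outside {rI, rLen} {aCand} s s' \<Longrightarrow> Q t s'"
  shows "quiet append_all Q s"
  unfolding append_all_def
proof (rule quiet_For[where I = "\<lambda>k s'. cands s' = cands s @ [0..<k]" and T = 2
      and R = "{rI, rLen}" and A = "{aCand}"])
  show "cands (s\<lparr>reg := (reg s)(rI := 0)\<rparr>) = cands s @ [0..<0]"
    by (simp add: cands_def)
next
  fix k s' assume "cands s' = cands s @ [0..<k]" "reg s' rI = k"
    "same_outside {rI, rLen} {aCand} s s'"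
  then show "quiet append_cand (\<lambda>t s''. t \<le> 2 \<and>
      cands (s''\<lparr>reg := (reg s'')(rI := Suc k)\<rparr>) = cands s @ [0..<Suc k]) s'"
    using assms(1) by (auto simp: append_cand_def same_outside_def input_ok_def cands_def)
qed (use assms in \<open>auto simp: input_ok_def append_cand_def\<close>)

lemma quiet_start_cands:
  assumes "input_ok a b m s"
    and Q: "\<And>t s'. t \<le> 12 * m + 5 \<Longrightarrow>
      cands s' = reg s rE # filter (\<lambda>i. arr s aQueue (reg s rHeadPtr + i) = 1 \<and>
         a i \<noteq> reg s rV \<and> b i \<noteq> reg s rV) [0..<m] \<Longrightarrow>
      same_outside {rI, rLen, rPtr, rS, rJunk} {aCand} s s' \<Longrightarrow> Q t s'"
  shows "quiet start_cands Q s"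
proof -
  let ?P = "\<lambda>i. arr s aQueue (reg s rHeadPtr + i) = 1 \<and> a i \<noteq> reg s rV \<and> b i \<noteq> reg s rV"
  let ?I = "\<lambda>k s'. cands s' = reg s rE # filter ?P [0..<k] \<and> reg s' rPtr = reg s rHeadPtr + k"
  have [simp]: "reg s 2 = 1" "reg s 3 = 0" "arr s 0 = a" "arr s 1 = b" "arr s (Suc 0) = b" "reg s 0 = m"
    using assms(1) by (auto simp: input_ok_def)
  show ?thesis
    unfolding start_cands_def quiet_Seq quiet_Do
    by (simp add: code_defs, rule quiet_For[where I = ?I and T = 10
        and R = "{rI, rLen, rPtr, rS, rJunk}" and A = "{aCand}"])
      (auto simp: cands_def same_outside_def intro!: Q)
qed

section \<open>Component labels and parities\<close>

text \<open>
  The proper colourings are parametrised by one free bit \<open>g\<close> per component label \<open>L x\<close>, with \<open>C x\<close>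
  recording the parity of \<open>x\<close> within its component.
\<close>

definition labelled ::
  "(nat \<Rightarrow> nat) \<Rightarrow> (nat \<Rightarrow> nat) \<Rightarrow> nat \<Rightarrow> (nat \<Rightarrow> nat) \<Rightarrow> (nat \<Rightarrow> nat) \<Rightarrow> nat set \<Rightarrow> bool" where
  "labelled a b m L C G \<longleftrightarrow> G \<subseteq> {..<m} \<and>
     (\<forall>x \<in> a ` {..<m} \<union> b ` {..<m}. C x \<le> 1) \<and>
     (\<forall>c. proper a b G c \<longleftrightarrow>
       (\<exists>g. \<forall>x \<in> a ` {..<m} \<union> b ` {..<m}. c x = (g (L x) \<noteq> (C x = 1))))"

lemma labelled_subset: "labelled a b m L C G \<Longrightarrow> G \<subseteq> {..<m}"
  by (simp add: labelled_def)

lemma labelled_colour_le: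
  assumes "labelled a b m L C G" "i < m"
  shows "C (a i) \<le> 1" "C (b i) \<le> 1"
  using assms unfolding labelled_def by blast+

lemma labelled_proper:
  assumes "labelled a b m L C G"
  shows "proper a b G c \<longleftrightarrow>
    (\<exists>g. \<forall>x \<in> a ` {..<m} \<union> b ` {..<m}. c x = (g (L x) \<noteq> (C x = 1)))"
  using assms unfolding labelled_def by blast

lemma labelled_bip:
  assumes "labelled a b m L C G"
  shows "proper a b G (\<lambda>x. C x \<noteq> 1)"
  unfolding labelled_proper[OF assms] by (rule exI[of _ "\<lambda>_. True"]) simp

text \<open>Both endpoints share one free bit, which cancels when their colours are compared. So
  either all proper colourings of \<open>G\<close> respect the edge or none does.\<close>

lemma labelled_same:
  assumes lab: "labelled a b m L C G" and i: "i < m" "L (a i) = L (b i)"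
  shows "bip a b (insert i G) \<longleftrightarrow> C (a i) \<noteq> C (b i)"
    and "C (a i) \<noteq> C (b i) \<Longrightarrow> labelled a b m L C (insert i G)"
proof -
  have *: "c (a i) \<noteq> c (b i) \<longleftrightarrow> C (a i) \<noteq> C (b i)" if c: "proper a b G c" for c
  proof -
    obtain g where "\<forall>x \<in> a ` {..<m} \<union> b ` {..<m}. c x = (g (L x) \<noteq> (C x = 1))"
      using c labelled_proper[OF lab] by blast
    then have "c (a i) = (g (L (a i)) \<noteq> (C (a i) = 1))" "c (b i) = (g (L (b i)) \<noteq> (C (b i) = 1))"
      using i by blast+
    then show ?thesis using i labelled_colour_le[OF lab i(1)] by (cases "g (L (b i))") auto
  qed
  have ins: "proper a b (insert i G) c \<longleftrightarrow> proper a b G c \<and> c (a i) \<noteq> c (b i)" for c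
    by (auto simp: proper_def)
  show "bip a b (insert i G) \<longleftrightarrow> C (a i) \<noteq> C (b i)"
    using labelled_bip[OF lab] * unfolding bip_def ins by blast
  show "labelled a b m L C (insert i G)" if "C (a i) \<noteq> C (b i)"
  proof -
    have "proper a b (insert i G) c \<longleftrightarrow> proper a b G c" for c
      using * that unfolding ins by blast
    then show ?thesis using lab i by (simp add: labelled_def)
  qed
qed

text \<open>
  The edge \<open>i\<close> forces one relation between the values of \<open>g\<close> at the two labels, which lets
  the label of \<open>a i\<close> be expressed through that of \<open>b i\<close>.
\<close>

lemma labelled_merge:
  assumes lab: "labelled a b m L C G" and i: "i < m" "L (a i) \<noteq> L (b i)"
    and L': "\<And>x. x \<in> a ` {..<m} \<union> b ` {..<m} \<Longrightarrow> L' x = (if L x = L (a i) then L (b i) else L x)"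
    and C': "\<And>x. x \<in> a ` {..<m} \<union> b ` {..<m} \<Longrightarrow>
      C' x = (if L x = L (a i) \<and> C (a i) = C (b i) then 1 - C x else C x)"
  shows "labelled a b m L' C' (insert i G)" and "bip a b (insert i G)"
proof -
  let ?V = "a ` {..<m} \<union> b ` {..<m}"
  have ends: "a i \<in> ?V" "b i \<in> ?V" using i by auto
  have le: "C x \<le> 1" if "x \<in> ?V" for x using lab that unfolding labelled_def by blast
  have flip: "(1 - C x = 1) \<longleftrightarrow> C x \<noteq> 1" if "x \<in> ?V" for x using le[OF that] by linarith
  have eq: "(C (a i) = C (b i)) \<longleftrightarrow> (C (a i) = 1) = (C (b i) = 1)"
    using le[OF ends(1)] le[OF ends(2)] by linarith
  have "(\<exists>g. \<forall>x\<in>?V. c x = (g (L' x) \<noteq> (C' x = 1))) \<longleftrightarrow>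
      (\<exists>g. \<forall>x\<in>?V. c x = (g (L x) \<noteq> (C x = 1))) \<and> c (a i) \<noteq> c (b i)" for c
  proof
    assume "\<exists>g. \<forall>x\<in>?V. c x = (g (L' x) \<noteq> (C' x = 1))"
    then obtain g where "\<forall>x\<in>?V. c x = (g (L' x) \<noteq> (C' x = 1))" by (elim exE)
    note g = bspec[OF this]
    \<comment> \<open>After the merge no vertex carries the label \<open>L (a i)\<close>, so its bit
      is free to take the value that the edge \<open>i\<close> forces.\<close>
    let ?g = "g(L (a i) := (g (L (b i)) \<noteq> (C (a i) = C (b i))))"
    have "c x = (?g (L x) \<noteq> (C x = 1))" if "x \<in> ?V" for x
      using g[OF that] L'[OF that] C'[OF that] flip[OF that] by auto
    moreover have "c (a i) \<noteq> c (b i)"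
      using g[OF ends(1)] g[OF ends(2)] L'[OF ends(1)] L'[OF ends(2)] C'[OF ends(1)]
        C'[OF ends(2)] flip[OF ends(1)] eq i by auto
    ultimately show "(\<exists>g. \<forall>x\<in>?V. c x = (g (L x) \<noteq> (C x = 1))) \<and> c (a i) \<noteq> c (b i)"
      by (intro conjI exI[of _ ?g] ballI)
  next
    assume "(\<exists>g. \<forall>x\<in>?V. c x = (g (L x) \<noteq> (C x = 1))) \<and> c (a i) \<noteq> c (b i)"
    then obtain g where "\<forall>x\<in>?V. c x = (g (L x) \<noteq> (C x = 1))" and ne: "c (a i) \<noteq> c (b i)"
      by (elim conjE exE)
    note g = bspec[OF this(1)]
    have rel: "g (L (a i)) = (g (L (b i)) \<noteq> (C (a i) = C (b i)))"
      using g[OF ends(1)] g[OF ends(2)] ne eq by auto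
    have "c x = (g (L' x) \<noteq> (C' x = 1))" if "x \<in> ?V" for x
      using g[OF that] L'[OF that] C'[OF that] flip[OF that] rel by auto
    then show "\<exists>g. \<forall>x\<in>?V. c x = (g (L' x) \<noteq> (C' x = 1))" by (intro exI[of _ g] ballI)
  qed
  moreover have "C' x \<le> 1" if "x \<in> ?V" for x using C'[OF that] le[OF that] by auto
  moreover have "proper a b (insert i G) c \<longleftrightarrow> proper a b G c \<and> c (a i) \<noteq> c (b i)" for c
    by (auto simp: proper_def)
  ultimately show lab': "labelled a b m L' C' (insert i G)"
    using labelled_subset[OF lab] i unfolding labelled_def labelled_proper[OF lab] by simp
  from labelled_bip[OF this] show "bip a b (insert i G)" by (auto simp: bip_def)
qed

lemma labelled_init:
  assumes "\<And>x. x \<in> a ` {..<m} \<union> b ` {..<m} \<Longrightarrow> L x = x \<and> C x = 0"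
  shows "labelled a b m L C {}"
proof -
  have "\<exists>g. \<forall>x \<in> a ` {..<m} \<union> b ` {..<m}. c x = (g (L x) \<noteq> (C x = 1))" for c
    using assms by (intro exI[of _ c]) simp
  then show ?thesis using assms by (simp add: labelled_def proper_def)
qed

section \<open>Greedy completion on the machine\<close>

definition sol_array :: "nat \<Rightarrow> state \<Rightarrow> nat set \<Rightarrow> bool" where
  "sol_array m s G \<longleftrightarrow> G \<subseteq> {..<m} \<and> (\<forall>i<m. arr s aSol i = of_bool (i \<in> G))"

definition greedy_state :: "(nat \<Rightarrow> nat) \<Rightarrow> (nat \<Rightarrow> nat) \<Rightarrow> nat \<Rightarrow> state \<Rightarrow> nat set \<Rightarrow> bool" where
  "greedy_state a b m s G \<longleftrightarrow>
     labelled a b m (arr s aLabel) (arr s aColour) G \<and> sol_array m s G"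

text \<open>Initialising endpoints of edges only keeps the cost independent of \<open>n\<close>, and
  it overwrites everything an earlier run left at vertices that will be consulted.\<close>

lemma quiet_init_labels:
  assumes "input_ok a b m s"
    and Q: "\<And>t s'. t \<le> 9 * m + 2 \<Longrightarrow> greedy_state a b m s' {} \<Longrightarrow>
      same_outside {rI, rX} {aLabel, aColour, aSol} s s' \<Longrightarrow> Q t s'"
  shows "quiet init_labels Q s"
proof -
  have [simp]: "reg s 2 = 1" "reg s 3 = 0" "arr s 0 = a" "arr s 1 = b" "arr s (Suc 0) = b" "reg s 0 = m"
    using assms(1) by (auto simp: input_ok_def)
  let ?I = "\<lambda>k s'. \<forall>i<k. arr s' aLabel (a i) = a i \<and> arr s' aLabel (b i) = b i \<and>
    arr s' aColour (a i) = 0 \<and> arr s' aColour (b i) = 0 \<and> arr s' aSol i = 0"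
  show ?thesis
    unfolding init_labels_def
  proof (rule quiet_For[where I = ?I and T = 7
        and R = "{rI, rX}" and A = "{aLabel, aColour, aSol}"])
    fix k s'
    assume "?I k s'" "reg s' rI = k" "same_outside {rI, rX} {aLabel, aColour, aSol} s s'"
    then show "quiet (init_vertex 0 ;; init_vertex 1 ;; Do (Store aSol rI rZero))
        (\<lambda>t s''. t \<le> 7 \<and> ?I (Suc k) (s''\<lparr>reg := (reg s'')(rI := Suc k)\<rparr>)) s'"
      by (simp add: init_vertex_def same_outside_def less_Suc_eq)
  next
    fix t s'
    assume t: "t \<le> reg s rM * (7 + 2) + 2" and I: "?I (reg s rM) s'"
      and same: "same_outside {rI, rX} {aLabel, aColour, aSol} s s'"
    have "labelled a b m (arr s' aLabel) (arr s' aColour) {}"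
      by (rule labelled_init) (use I in auto)
    moreover have "sol_array m s' {}" using I by (simp add: sol_array_def)
    ultimately show "Q t s'" using t same
      by (intro Q) (simp_all add: greedy_state_def init_vertex_def)
  qed (simp_all add: init_vertex_def)
qed

lemma quiet_relabel:
  assumes "input_ok a b m s" and ne: "reg s rLu \<noteq> reg s rLw"
    and Q: "\<And>t s'. t \<le> 20 * m + 2 \<Longrightarrow>
      (\<And>x. x \<in> a ` {..<m} \<union> b ` {..<m} \<Longrightarrow>
        arr s' aLabel x = (if arr s aLabel x = reg s rLu then reg s rLw else arr s aLabel x) \<and>
        arr s' aColour x =
          (if arr s aLabel x = reg s rLu \<and> reg s rCu = reg s rCw
           then 1 - arr s aColour x else arr s aColour x)) \<Longrightarrow>
      same_outside {rK, rX, rS, rT, rJunk} {aLabel, aColour} s s' \<Longrightarrow> Q t s'"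
  shows "quiet relabel Q s"
proof -
  have [simp]: "reg s 2 = 1" "reg s 3 = 0" "arr s 0 = a" "arr s 1 = b" "arr s (Suc 0) = b" "reg s 0 = m"
    using assms(1) by (auto simp: input_ok_def)
  define L where "L x = (if arr s aLabel x = reg s rLu then reg s rLw else arr s aLabel x)" for x
  define C where "C x = (if arr s aLabel x = reg s rLu \<and> reg s rCu = reg s rCw
           then 1 - arr s aColour x else arr s aColour x)" for x
  \<comment> \<open>The invariant is indexed by the set \<open>W\<close> of vertices already
    treated, because an endpoint shared by several edges is visited repeatedly. By
    \<open>ne\<close>, a vertex in \<open>W\<close> no longer has the label to be replaced, so
    further visits do not flip its colour back.\<close>
  let ?I = "\<lambda>W s' :: state. \<forall>x. arr s' aLabel x = (if x \<in> W then L x else arr s aLabel x) \<and>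
    arr s' aColour x = (if x \<in> W then C x else arr s aColour x)"
  let ?I' = "\<lambda>k s' :: state. ?I (a ` {..<k} \<union> b ` {..<k}) s'"
  have vertex: "quiet (relabel_vertex e) Q' s'"
    if "?I W s'" "same_outside {rK, rX, rS, rT, rJunk} {aLabel, aColour} s s'" "e \<notin> {aLabel, aColour}"
      "\<And>t s''. t \<le> 8 \<Longrightarrow> ?I (insert (arr s e (reg s' rK)) W) s'' \<Longrightarrow>
        same_outside {rX, rS, rT, rJunk} {aLabel, aColour} s' s'' \<Longrightarrow> Q' t s''" for W s' e Q'
    using that ne unfolding relabel_vertex_def skip_def
    by (auto simp: same_outside_def L_def C_def intro!: that(4))
  have body: "quiet (relabel_vertex 0 ;; relabel_vertex 1) (\<lambda>t s''. t \<le> 18 \<and>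
      ?I' (Suc k) (s''\<lparr>reg := (reg s'')(rK := Suc k)\<rparr>)) s'"
    if "?I' k s'" "reg s' rK = k"
      "same_outside {rK, rX, rS, rT, rJunk} {aLabel, aColour} s s'" for k s'
    unfolding quiet_Seq
  proof (rule vertex[OF that(1,3)])
    fix t :: nat and s''
    assume 1: "t \<le> 8" "?I (insert (arr s 0 (reg s' rK)) (a ` {..<k} \<union> b ` {..<k})) s''"
      "same_outside {rX, rS, rT, rJunk} {aLabel, aColour} s' s''"
    have 2: "same_outside {rK, rX, rS, rT, rJunk} {aLabel, aColour} s s''"
      using 1 that by (auto simp: same_outside_def)
    have k: "reg s'' rK = k" using 1 that by (auto simp: same_outside_def)
    show "quiet (relabel_vertex 1) (\<lambda>t' s3. t + t' \<le> 18 \<and>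
      ?I' (Suc k) (s3\<lparr>reg := (reg s3)(rK := Suc k)\<rparr>)) s''"
      by (rule vertex[OF 1(2) 2]) (use 1 k that in \<open>auto simp: lessThan_Suc\<close>)
  qed simp
  show ?thesis
    unfolding relabel_def
  proof (rule quiet_For[where I = "\<lambda>k s'. ?I' k s'" and T = 18
        and R = "{rK, rX, rS, rT, rJunk}" and A = "{aLabel, aColour}"], goal_cases)
    case 8
    then show ?case by (intro body)
  next
    case (9 t s')
    then show ?case by (intro Q) (simp_all add: L_def C_def)
  qed (auto simp: relabel_vertex_def skip_def)
qed

abbreviation (input) "greedy_regs \<equiv> {rI, rJ, rK, rX, rS, rT, rJunk, rLu, rLw, rCu, rCw}"

lemma sol_array_insert:
  assumes "sol_array m s G" "i < m" "arr s' aSol = (arr s aSol)(i := 1)"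
  shows "sol_array m s' (insert i G)"
  using assms by (auto simp: sol_array_def)

lemma quiet_add_edge:
  assumes ok: "input_ok a b m s" and gs: "greedy_state a b m s G" and i: "reg s rI = i" "i < m"
    and Q: "\<And>t s'. t \<le> 20 * m + 12 \<Longrightarrow> greedy_state a b m s' (try_add a b G i) \<Longrightarrow>
      same_outside (greedy_regs - {rI, rJ}) {aLabel, aColour, aSol} s s' \<Longrightarrow> Q t s'"
  shows "quiet add_edge Q s"
proof -
  have [simp]: "reg s 2 = 1" "reg s 3 = 0" "arr s 0 = a" "arr s 1 = b" "arr s (Suc 0) = b"
    "reg s 0 = m" "reg s rI = i"
    using ok i by (auto simp: input_ok_def)
  let ?L = "arr s aLabel" and ?C = "arr s aColour"
  have lab: "labelled a b m ?L ?C G" and sol: "sol_array m s G"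
    using gs by (auto simp: greedy_state_def)
  show ?thesis
  proof (cases "?L (a i) = ?L (b i)")
    case True
    note same = labelled_same[OF lab i(2) True]
    show ?thesis
    proof (cases "?C (a i) = ?C (b i)")
      case eq: True
      then have "try_add a b G i = G" using same by (simp add: try_add_def)
      then show ?thesis
        using True eq lab sol
        by (auto simp: add_edge_def skip_def same_outside_def greedy_state_def sol_array_def intro!: Q)
    next
      case False
      then have "try_add a b G i = insert i G" using same by (simp add: try_add_def)
      then show ?thesis
        using True False same(2) sol_array_insert[OF sol i(2)]
        by (auto simp: add_edge_def same_outside_def greedy_state_def intro!: Q)
    qed
  next
    case False
    have merged: "greedy_state a b m s' (try_add a b G i)"
      if "\<And>x. x \<in> a ` {..<m} \<union> b ` {..<m} \<Longrightarrow>
          arr s' aLabel x = (if ?L x = ?L (a i) then ?L (b i) else ?L x) \<and>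
          arr s' aColour x = (if ?L x = ?L (a i) \<and> ?C (a i) = ?C (b i) then 1 - ?C x else ?C x)"
        and "arr s' aSol = (arr s aSol)(i := 1)" for s'
    proof -
      note merge = labelled_merge[OF lab i(2) False, of "arr s' aLabel" "arr s' aColour"]
      have "labelled a b m (arr s' aLabel) (arr s' aColour) (insert i G)" "bip a b (insert i G)"
        using merge that(1) by blast+
      then show ?thesis
        using sol_array_insert[OF sol i(2) that(2)] by (simp add: greedy_state_def try_add_def)
    qed
    have relabelled: "quiet relabel P s1"
      if ok1: "input_ok a b m s1"
        and regs: "reg s1 rLu = ?L (a i)" "reg s1 rLw = ?L (b i)" "reg s1 rCu = ?C (a i)"
          "reg s1 rCw = ?C (b i)"
        and arrs: "arr s1 aLabel = ?L" "arr s1 aColour = ?C" "arr s1 aSol = (arr s aSol)(i := 1)"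
        and s1: "same_outside (greedy_regs - {rI, rJ}) {aSol} s s1"
        and P: "\<And>t s'. t \<le> 20 * m + 2 \<Longrightarrow> greedy_state a b m s' (try_add a b G i) \<Longrightarrow>
          same_outside (greedy_regs - {rI, rJ}) {aLabel, aColour, aSol} s s' \<Longrightarrow> P t s'" for s1 P
    proof (rule quiet_relabel[OF ok1], unfold regs arrs)
      fix t s'
      assume t: "t \<le> 20 * m + 2"
        and eff: "\<And>x. x \<in> a ` {..<m} \<union> b ` {..<m} \<Longrightarrow>
          arr s' aLabel x = (if ?L x = ?L (a i) then ?L (b i) else ?L x) \<and>
          arr s' aColour x = (if ?L x = ?L (a i) \<and> ?C (a i) = ?C (b i) then 1 - ?C x else ?C x)"
        and same: "same_outside {rK, rX, rS, rT, rJunk} {aLabel, aColour} s1 s'"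
      have "arr s' aSol = (arr s aSol)(i := 1)" using same arrs(3) by (simp add: same_outside_def)
      with eff have "greedy_state a b m s' (try_add a b G i)" by (rule merged)
      then show "P t s'" using t same s1 by (intro P) (auto simp: same_outside_def)
    qed (rule False)
    show ?thesis
      unfolding add_edge_def using False
      by (simp, intro relabelled) (auto simp: input_ok_def same_outside_def intro!: Q)
  qed
qed

lemma quiet_run_greedy:
  assumes ok: "input_ok a b m s" and xs: "cands s = xs" "set xs \<subseteq> {..<m}" "length xs \<le> 2 * m + 1"
    and Q: "\<And>t s'. t \<le> 40 * m * m + 59 * m + 19 \<Longrightarrow> sol_array m s' (greedy a b xs) \<Longrightarrow>
      same_outside greedy_regs {aLabel, aColour, aSol} s s' \<Longrightarrow> Q t s'"
  shows "quiet run_greedy Q s"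
  unfolding run_greedy_def quiet_Seq
proof (rule quiet_init_labels[OF ok])
  fix t s1
  assume t: "t \<le> 9 * m + 2" and init: "greedy_state a b m s1 {}"
    and s1: "same_outside {rI, rX} {aLabel, aColour, aSol} s s1"
  have len: "reg s1 rLen = length xs" using s1 xs by (auto simp: same_outside_def cands_def)
  have ok1: "input_ok a b m s1" using ok s1 by (auto simp: same_outside_def input_ok_def)
  have nth: "arr s1 aCand k = xs ! k" if "k < length xs" for k
    using s1 xs that by (auto simp: same_outside_def cands_def)
  let ?I = "\<lambda>k s'. greedy_state a b m s' (greedy a b (take k xs))"
  \<comment> \<open>At most \<open>2 * m + 1\<close> candidates cost \<open>20 * m + 15\<close> each
    including loop overhead; adding \<open>9 * m + 4\<close> for the initialisation of the labels
    and the ends of the loop gives the bound.\<close>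
  have "length xs * (20 * m + 15) \<le> (2 * m + 1) * (20 * m + 15)"
    using xs(3) by (rule mult_le_mono1)
  then have time: "t + (length xs * (20 * m + 13 + 2) + 2) \<le> 40 * m * m + 59 * m + 19"
    using t by (simp add: algebra_simps)
  show "quiet (For rJ rLen (Do (Load rI aCand rJ) ;; add_edge)) (\<lambda>t' s''. Q (t + t') s'') s1"
  proof (rule quiet_For[where I = ?I and T = "20 * m + 13"
        and R = greedy_regs and A = "{aLabel, aColour, aSol}"], goal_cases)
    case 1
    show ?case using init by (simp add: greedy_def greedy_state_def sol_array_def)
  next
    case (8 k s')
    then have k: "k < length xs" by (simp add: len)
    let ?s = "s'\<lparr>reg := (reg s')(rI := xs ! k)\<rparr>"
    have cand: "arr s' aCand k = xs ! k" using 8 nth[OF k] by (simp add: same_outside_def)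
    have step: "greedy a b (take (Suc k) xs) = try_add a b (greedy a b (take k xs)) (xs ! k)"
      using k by (simp add: take_Suc_conv_app_nth greedy_def)
    have "quiet add_edge (\<lambda>t' s''. Suc t' \<le> 20 * m + 13 \<and>
        ?I (Suc k) (s''\<lparr>reg := (reg s'')(rJ := Suc k)\<rparr>)) ?s"
    proof (rule quiet_add_edge[where i = "xs ! k" and G = "greedy a b (take k xs)"])
      show "input_ok a b m ?s" using ok1 8 by (simp add: input_ok_def same_outside_def)
      show "greedy_state a b m ?s (greedy a b (take k xs))"
        using 8 by (simp add: greedy_state_def sol_array_def)
      show "xs ! k < m" using xs(2) k by (meson lessThan_iff nth_mem subsetD)
    qed (auto simp: step greedy_state_def sol_array_def)
    then show ?case using 8(3) cand by simp
  next
    case (9 t' s')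
    then have "sol_array m s' (greedy a b xs)" by (simp add: len greedy_state_def)
    moreover have "t + t' \<le> 40 * m * m + 59 * m + 19" using 9(1) time by (simp add: len)
    ultimately show ?case using 9(4) s1 by (intro Q) (auto simp: same_outside_def)
  qed (use ok1 in \<open>auto simp: input_ok_def add_edge_def relabel_def relabel_vertex_def skip_def\<close>)
qed

section \<open>The trie of known solutions\<close>

text \<open>
  Node \<open>k\<close> of the trie spells the word \<open>ns ! k\<close>.  The root has number 0 and is nobody's child, so the
  child pointer 0 means that there is no child.
\<close>

definition trie :: "bool list list \<Rightarrow> (bool \<Rightarrow> nat \<Rightarrow> nat) \<Rightarrow> bool" where
  "trie ns ch \<longleftrightarrow> distinct ns \<and> ns \<noteq> [] \<and> hd ns = [] \<and>
     (\<forall>xs x. xs @ [x] \<in> set ns \<longrightarrow> xs \<in> set ns) \<and>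
     (\<forall>x. \<forall>k \<ge> length ns. ch x k = 0) \<and>
     (\<forall>x. \<forall>k < length ns.
        if ch x k = 0 then ns ! k @ [x] \<notin> set ns
        else ch x k < length ns \<and> ns ! ch x k = ns ! k @ [x])"

text \<open>The new node rightly starts without children: by closure under prefixes, a stored
  extension of its word would have put the word itself into the trie.\<close>

lemma trie_extend:
  assumes tr: "trie ns ch" and k: "k < length ns" and none: "ch x k = 0"
  shows "trie (ns @ [ns ! k @ [x]]) (ch(x := (ch x)(k := length ns)))"
proof -
  let ?ns = "ns @ [ns ! k @ [x]]" and ?ch = "ch(x := (ch x)(k := length ns))"
  have dist: "distinct ns" and closed: "\<And>xs x. xs @ [x] \<in> set ns \<Longrightarrow> xs \<in> set ns"
    and out: "\<And>x k. k \<ge> length ns \<Longrightarrow> ch x k = 0"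
    and child: "\<And>x k. k < length ns \<Longrightarrow> if ch x k = 0 then ns ! k @ [x] \<notin> set ns
        else ch x k < length ns \<and> ns ! ch x k = ns ! k @ [x]"
    using tr unfolding trie_def by blast+
  have new: "ns ! k @ [x] \<notin> set ns" using child[OF k, of x] none by simp
  have "if ?ch y j = 0 then ?ns ! j @ [y] \<notin> set ?ns
      else ?ch y j < length ?ns \<and> ?ns ! ?ch y j = ?ns ! j @ [y]" if j: "j < length ?ns" for y j
  proof (cases "j = length ns")
    case True
    have "(ns ! k @ [x]) @ [y] \<notin> set ns" using new closed by blast
    with True k out[of j] show ?thesis by auto
  next
    case False
    with j have j': "j < length ns" by simp
    show ?thesis
    proof (cases "j = k \<and> y = x")
      case True
      with k show ?thesis by (auto simp: nth_append)
    next
      case other: False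
      then have ch: "?ch y j = ch y j" by auto
      have "ns ! j @ [y] \<noteq> ns ! k @ [x]" using other dist j' k by (auto simp: nth_eq_iff_index_eq)
      with child[OF j', of y] j' show ?thesis unfolding ch by (auto simp: nth_append)
    qed
  qed
  moreover have "distinct ?ns" using dist new by simp
  moreover have "xs \<in> set ?ns" if "xs @ [y] \<in> set ?ns" for xs y
    using that closed k by auto
  moreover have "?ch y j = 0" if "j \<ge> length ?ns" for y j using out[of j y] that k by auto
  moreover have "hd ?ns = []" using tr by (auto simp: trie_def)
  ultimately show ?thesis unfolding trie_def by blast
qed

definition children :: "state \<Rightarrow> bool \<Rightarrow> nat \<Rightarrow> nat" where
  "children s x = arr s (if x then aOne else aZero)"

lemma children_reg [simp]: "children (s\<lparr>reg := f\<rparr>) = children s"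
  by (simp add: children_def fun_eq_iff)

definition trie_state :: "state \<Rightarrow> bool list list \<Rightarrow> bool" where
  "trie_state s ns \<longleftrightarrow> trie ns (children s) \<and> reg s rNodes = length ns"

definition bits :: "nat \<Rightarrow> nat set \<Rightarrow> bool list" where
  "bits m G = map (\<lambda>i. i \<in> G) [0..<m]"

lemma length_bits [simp]: "length (bits m G) = m"
  by (simp add: bits_def)

lemma take_Suc_bits: "k < m \<Longrightarrow> take (Suc k) (bits m G) = take k (bits m G) @ [k \<in> G]"
  by (simp add: take_Suc_conv_app_nth bits_def)

text \<open>The flag compares with the trie \<open>ns\<close> before the insertion, since the
  growing trie \<open>ns'\<close> always contains the prefix just read.\<close>

definition trie_walk :: "nat \<Rightarrow> nat set \<Rightarrow> bool list list \<Rightarrow> nat \<Rightarrow> state \<Rightarrow> bool" where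
  "trie_walk m G ns k s \<longleftrightarrow> (\<exists>ns'. trie_state s ns' \<and>
     set ns' = set ns \<union> (\<lambda>j. take j (bits m G)) ` {..k} \<and>
     reg s rNode < length ns' \<and> ns' ! reg s rNode = take k (bits m G) \<and>
     reg s rNew = of_bool (take k (bits m G) \<notin> set ns))"

abbreviation (input) "trie_regs \<equiv> {rI, rS, rNodes, rNew, rNode, rBit}"

lemma quiet_trie_insert:
  assumes ok: "input_ok a b m s" and sol: "sol_array m s G" and tr: "trie_state s ns"
    and Q: "\<And>t s' ns'. t \<le> 12 * m + 4 \<Longrightarrow> trie_state s' ns' \<Longrightarrow>
      set ns' = set ns \<union> (\<lambda>j. take j (bits m G)) ` {..m} \<Longrightarrow>
      reg s' rNew = of_bool (bits m G \<notin> set ns) \<Longrightarrow>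
      same_outside trie_regs {aOne, aZero} s s' \<Longrightarrow> Q t s'"
  shows "quiet trie_insert Q s"
proof -
  have [simp]: "reg s 2 = 1" "reg s 3 = 0" "reg s 0 = m" using ok by (auto simp: input_ok_def)
  let ?s = "s\<lparr>reg := (reg s)(rNode := 0, rNew := 0)\<rparr>"
  have hd: "hd ns = []" "ns \<noteq> []" using tr by (auto simp: trie_state_def trie_def)
  have "quiet (For rI rM
      (Do (Load rBit aSol rI) ;;
       If (Equal rBit rOne) (Do (Load rS aOne rNode)) (Do (Load rS aZero rNode)) ;;
       If (Equal rS rZero)
        (Do (Move rS rNodes) ;; Do (Add rNodes rNodes rOne) ;;
         If (Equal rBit rOne) (Do (Store aOne rNode rS)) (Do (Store aZero rNode rS)) ;;
         Do (Const rNew 1))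
        (Do (Const rNew 0)) ;;
       Do (Move rNode rS))) (\<lambda>t s'. Q (2 + t) s') ?s"
  proof (rule quiet_For[where I = "trie_walk m G ns" and T = 10
        and R = trie_regs and A = "{aOne, aZero}"], goal_cases)
    case 1
    have "set ns = set ns \<union> (\<lambda>j. take j (bits m G)) ` {..0}" using hd hd_in_set by fastforce
    moreover have "trie_state (?s\<lparr>reg := (reg ?s)(rI := 0)\<rparr>) ns"
      using tr by (simp add: trie_state_def)
    ultimately show ?case
      using hd unfolding trie_walk_def
      by (intro exI[of _ ns]) (auto simp: hd_conv_nth)
  next
    case (8 k s')
    then have k: "k < m" by simp
    from 8(2) obtain ns' where ns': "trie_state s' ns'"
      "set ns' = set ns \<union> (\<lambda>j. take j (bits m G)) ` {..k}"
      "reg s' rNode < length ns'" "ns' ! reg s' rNode = take k (bits m G)"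
      unfolding trie_walk_def by blast
    let ?x = "k \<in> G" and ?n = "reg s' rNode"
    define c where "c = children s' ?x ?n"
    have tr': "trie ns' (children s')" and nodes: "reg s' rNodes = length ns'"
      using ns'(1) by (auto simp: trie_state_def)
    have path: "ns' ! ?n @ [?x] = take (Suc k) (bits m G)"
      using ns'(4) k by (simp add: take_Suc_bits)
    have child: "if c = 0 then take (Suc k) (bits m G) \<notin> set ns'
        else c < length ns' \<and> ns' ! c = take (Suc k) (bits m G)"
      using tr' ns'(3) unfolding trie_def c_def path[symmetric] by blast
    \<comment> \<open>The walk has so far inserted only words of length at most \<open>k\<close>, so
      finding the next prefix in \<open>ns'\<close> means that it was already in
      \<open>ns\<close>.\<close>
    have "take (Suc k) (bits m G) \<notin> (\<lambda>j. take j (bits m G)) ` {..k}"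
      using k by (auto dest: arg_cong[where f = length])
    with child ns'(2) have new: "take (Suc k) (bits m G) \<in> set ns \<longleftrightarrow> c \<noteq> 0"
      by (metis UnE UnI1 nth_mem)
    have img: "(\<lambda>j. take j (bits m G)) ` {..Suc k} =
        insert (take (Suc k) (bits m G)) ((\<lambda>j. take j (bits m G)) ` {..k})"
      by (simp add: atMost_Suc)
    have bit: "arr s' aSol k = of_bool ?x"
      using 8(4) sol k by (simp add: same_outside_def sol_array_def)
    have regs: "reg s' rOne = 1" "reg s' rZero = 0" "reg s' rI = k"
      using 8 by (simp_all add: same_outside_def)
    show ?case
    proof (cases "c = 0")
      case True
      have walk: "trie_walk m G ns (Suc k) s''"
        if "children s'' = (children s')(?x := (children s' ?x)(?n := length ns'))"
          "reg s'' rNodes = Suc (length ns')" "reg s'' rNode = length ns'" "reg s'' rNew = 1" for s''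
        unfolding trie_walk_def
      proof (intro exI[of _ "ns' @ [ns' ! ?n @ [?x]]"] conjI)
        show "trie_state s'' (ns' @ [ns' ! ?n @ [?x]])"
          using that trie_extend[OF tr' ns'(3)] True by (simp add: trie_state_def c_def)
      qed (use that path ns'(2) img new True in auto)
      show ?thesis
        using regs bit True nodes
        by (cases "k \<in> G") (simp_all add: c_def children_def fun_eq_iff walk)
    next
      case False
      have walk: "trie_walk m G ns (Suc k) s''"
        if "children s'' = children s'" "reg s'' rNodes = length ns'" "reg s'' rNode = c"
          "reg s'' rNew = 0" for s''
        unfolding trie_walk_def
        by (intro exI[of _ ns'] conjI)
          (use that child False ns'(2) img new tr' in \<open>auto simp: trie_state_def\<close>)
      show ?thesis
        using regs bit False nodes
        by (cases "k \<in> G") (simp_all add: c_def children_def fun_eq_iff walk)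
    qed
  next
    case (9 t s')
    from 9(2) obtain ns' where "trie_state s' ns'"
      "set ns' = set ns \<union> (\<lambda>j. take j (bits m G)) ` {..m}"
      "reg s' rNew = of_bool (bits m G \<notin> set ns)"
      unfolding trie_walk_def by auto
    then show ?case using 9 by (intro Q[of _ _ ns']) (auto simp: same_outside_def)
  qed auto
  then show ?thesis by (simp add: trie_insert_def)
qed

lemma quiet_enqueue:
  assumes ok: "input_ok a b m s" and sol: "sol_array m s G"
    and Q: "\<And>t s'. t \<le> 5 * m + 3 \<Longrightarrow>
      (\<And>i. i < m \<Longrightarrow> arr s' aQueue (reg s rTailPtr + i) = of_bool (i \<in> G)) \<Longrightarrow>
      (\<And>p. p < reg s rTailPtr \<Longrightarrow> arr s' aQueue p = arr s aQueue p) \<Longrightarrow>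
      reg s' rTailPtr = reg s rTailPtr + m \<Longrightarrow> reg s' rTail = Suc (reg s rTail) \<Longrightarrow>
      same_outside {rI, rS, rTailPtr, rTail} {aQueue} s s' \<Longrightarrow> Q t s'"
  shows "quiet enqueue Q s"
  unfolding enqueue_def quiet_Seq
proof (rule quiet_For[where T = 3 and R = "{rI, rS, rTailPtr}" and A = "{aQueue}" and
    I = "\<lambda>k s'. (\<forall>i<k. arr s' aQueue (reg s rTailPtr + i) = of_bool (i \<in> G)) \<and>
      (\<forall>p<reg s rTailPtr. arr s' aQueue p = arr s aQueue p) \<and>
      reg s' rTailPtr = reg s rTailPtr + k"], goal_cases)
  case (8 k s')
  then show ?case
    using ok sol by (auto simp: same_outside_def input_ok_def sol_array_def less_Suc_eq)
next
  case (9 t s')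
  then show ?case using ok by (auto simp: same_outside_def input_ok_def intro!: Q)
qed (use ok in \<open>auto simp: input_ok_def\<close>)

section \<open>Search states\<close>

lemma bits_inject:
  assumes "G \<subseteq> {..<m}" "H \<subseteq> {..<m}" "bits m G = bits m H"
  shows "G = H"
proof -
  have "i \<in> G \<longleftrightarrow> i \<in> H" if "i < m" for i
    using arg_cong[OF assms(3), of "\<lambda>xs. xs ! i"] that by (simp add: bits_def)
  with assms(1,2) show ?thesis by blast
qed

text \<open>A prefix of full length is the whole word, so an insertion adds at most one such node,
  whatever inner nodes it creates.\<close>

lemma full_paths_insert:
  assumes "set ns' = set ns \<union> (\<lambda>j. take j (bits m G)) ` {..m}"
  shows "{xs \<in> set ns'. length xs = m} = insert (bits m G) {xs \<in> set ns. length xs = m}"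
proof -
  have "xs = bits m G" if "xs \<in> (\<lambda>j. take j (bits m G)) ` {..m}" "length xs = m" for xs
  proof -
    from that(1) obtain j where j: "xs = take j (bits m G)" by blast
    moreover have "m \<le> j" using arg_cong[OF j, of length] that(2) by simp
    ultimately show ?thesis by simp
  qed
  moreover have "bits m G \<in> (\<lambda>j. take j (bits m G)) ` {..m}" by (rule image_eqI[of _ _ m]) auto
  ultimately have "{xs \<in> (\<lambda>j. take j (bits m G)) ` {..m}. length xs = m} = {bits m G}" by auto
  then show ?thesis unfolding assms by auto
qed

definition queue_state :: "nat \<Rightarrow> nat set list \<Rightarrow> state \<Rightarrow> bool" where
  "queue_state m Gs s \<longleftrightarrow> reg s rTail = length Gs \<and> reg s rTailPtr = length Gs * m \<and>
     (\<forall>k<length Gs. \<forall>i<m. arr s aQueue (k * m + i) = of_bool (i \<in> Gs ! k))"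

text \<open>\<open>Gs\<close> contains all solutions found so far, including those already output,
  as the queue is never shortened. Shorter words in the trie are inner nodes and stand for no
  solution.\<close>

definition search_state ::
  "(nat \<Rightarrow> nat) \<Rightarrow> (nat \<Rightarrow> nat) \<Rightarrow> nat \<Rightarrow> nat set list \<Rightarrow> state \<Rightarrow> bool" where
  "search_state a b m Gs s \<longleftrightarrow> input_ok a b m s \<and> queue_state m Gs s \<and> distinct Gs \<and>
     (\<forall>G\<in>set Gs. maxbip a b m G) \<and>
     (\<exists>ns. trie_state s ns \<and> {xs \<in> set ns. length xs = m} = bits m ` set Gs)"

lemma search_state_same:
  assumes "search_state a b m Gs s" "same_outside R A s s'"
    "{rM, rOne, rZero, rTail, rTailPtr, rNodes} \<inter> R = {}" "{0, 1, aQueue, aOne, aZero} \<inter> A = {}"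
  shows "search_state a b m Gs s'"
proof -
  have "children s' = children s"
    using assms by (auto simp: fun_eq_iff children_def same_outside_def)
  then show ?thesis
    using assms by (simp add: search_state_def input_ok_def queue_state_def trie_state_def same_outside_def)
qed

lemma quiet_enqueue_queue:
  assumes ok: "input_ok a b m s" and sol: "sol_array m s G" and q: "queue_state m Gs s"
    and Q: "\<And>t s'. t \<le> 5 * m + 3 \<Longrightarrow> queue_state m (Gs @ [G]) s' \<Longrightarrow>
      same_outside {rI, rS, rTailPtr, rTail} {aQueue} s s' \<Longrightarrow> Q t s'"
  shows "quiet enqueue Q s"
proof (rule quiet_enqueue[OF ok sol])
  fix t s'
  assume t: "t \<le> 5 * m + 3"
    and new: "\<And>i. i < m \<Longrightarrow> arr s' aQueue (reg s rTailPtr + i) = of_bool (i \<in> G)"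
    and old: "\<And>p. p < reg s rTailPtr \<Longrightarrow> arr s' aQueue p = arr s aQueue p"
    and tail: "reg s' rTailPtr = reg s rTailPtr + m" "reg s' rTail = Suc (reg s rTail)"
    and same: "same_outside {rI, rS, rTailPtr, rTail} {aQueue} s s'"
  have "arr s' aQueue (k * m + i) = of_bool (i \<in> (Gs @ [G]) ! k)"
    if "k < Suc (length Gs)" "i < m" for k i
  proof (cases "k < length Gs")
    case True
    have "k * m + i < Suc k * m" using that by simp
    also have "\<dots> \<le> length Gs * m" using True by (intro mult_le_mono1) simp
    finally show ?thesis using True that q old by (simp add: nth_append queue_state_def)
  next
    case False
    then have "k = length Gs" using that by simp
    then show ?thesis using new[OF that(2)] q by (simp add: queue_state_def)
  qed
  then have "queue_state m (Gs @ [G]) s'" using q tail by (simp add: queue_state_def)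
  then show "Q t s'" using t same by (intro Q)
qed

abbreviation (input) "process_regs \<equiv> {rTail, rTailPtr, rNodes, rI, rPtr, rLen, rJ, rK, rX, rLu, rLw,
  rCu, rCw, rS, rT, rNew, rNode, rBit, rJunk}"

abbreviation (input) "process_arrs \<equiv> {aLabel, aColour, aCand, aSol, aQueue, aOne, aZero}"

lemma quiet_process:
  assumes st: "search_state a b m Gs s" and h: "h < length Gs" "reg s rHeadPtr = h * m"
    and e: "reg s rE = e" "e < m" "reg s rV = v"
    and Q: "\<And>t s' Gs'. t \<le> 120 * (m + 1) ^ 2 \<Longrightarrow> search_state a b m Gs' s' \<Longrightarrow>
      Gs' = Gs \<or> Gs' = Gs @ [neighbour a b m (Gs ! h) e v] \<Longrightarrow>
      neighbour a b m (Gs ! h) e v \<in> set Gs' \<Longrightarrow>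
      same_outside process_regs process_arrs s s' \<Longrightarrow> Q t s'"
  shows "quiet process Q s"
proof -
  have ok: "input_ok a b m s" and q: "queue_state m Gs s" and dist: "distinct Gs"
    and sols: "\<And>G. G \<in> set Gs \<Longrightarrow> maxbip a b m G"
    using st by (auto simp: search_state_def)
  obtain ns where tr: "trie_state s ns" and ns: "{xs \<in> set ns. length xs = m} = bits m ` set Gs"
    using st by (auto simp: search_state_def)
  let ?N = "neighbour a b m (Gs ! h) e v"
  have N: "maxbip a b m ?N" using e by (intro neighbour_maxbip)
  have known: "bits m ?N \<in> set ns \<longleftrightarrow> ?N \<in> set Gs"
  proof -
    have "bits m ?N \<in> set ns \<longleftrightarrow> bits m ?N \<in> bits m ` set Gs" unfolding ns[symmetric] by simp
    also have "\<dots> \<longleftrightarrow> ?N \<in> set Gs"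
      using bits_inject sols N unfolding maxbip_def by blast
    finally show ?thesis .
  qed
  show ?thesis
    unfolding process_def quiet_Seq
  proof (rule quiet_start_cands[OF ok])
    fix t1 s1
    assume t1: "t1 \<le> 12 * m + 5"
      and c1: "cands s1 = reg s rE # filter (\<lambda>i. arr s aQueue (reg s rHeadPtr + i) = 1 \<and>
         a i \<noteq> reg s rV \<and> b i \<noteq> reg s rV) [0..<m]"
      and s1: "same_outside {rI, rLen, rPtr, rS, rJunk} {aCand} s s1"
    have "input_ok a b m s1" using ok s1 by (auto simp: input_ok_def same_outside_def)
    then show "quiet append_all (\<lambda>t. quiet run_greedy (\<lambda>t'. quiet trie_insert
        (\<lambda>t''. quiet (If (Equal rNew rOne) enqueue skip)
          (\<lambda>t'''. Q (t1 + (t + (t' + (t'' + t''')))))))) s1"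
    proof (rule quiet_append_all)
      fix t2 s2
      assume t2: "t2 \<le> 4 * m + 2" and c2: "cands s2 = cands s1 @ [0..<m]"
        and s2: "same_outside {rI, rLen} {aCand} s1 s2"
      have "filter (\<lambda>i. arr s aQueue (h * m + i) = 1 \<and> a i \<noteq> v \<and> b i \<noteq> v) [0..<m] =
          filter (\<lambda>i. i \<in> Gs ! h \<and> a i \<noteq> v \<and> b i \<noteq> v) [0..<m]"
        using q h by (intro filter_cong) (auto simp: queue_state_def)
      then have cand: "cands s2 = candidates a b m (Gs ! h) e v"
        using c1 c2 h e by (simp add: candidates_def)
      have "input_ok a b m s2" using ok s1 s2 by (auto simp: input_ok_def same_outside_def)
      then show "quiet run_greedy (\<lambda>t'. quiet trie_insert
        (\<lambda>t''. quiet (If (Equal rNew rOne) enqueue skip)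
          (\<lambda>t'''. Q (t1 + (t2 + (t' + (t'' + t''')))))) ) s2"
      proof (rule quiet_run_greedy)
        show "cands s2 = candidates a b m (Gs ! h) e v" by (rule cand)
        show "set (candidates a b m (Gs ! h) e v) \<subseteq> {..<m}" using e by (auto simp: candidates_def)
        show "length (candidates a b m (Gs ! h) e v) \<le> 2 * m + 1"
          using length_filter_le[of "\<lambda>i. i \<in> Gs ! h \<and> a i \<noteq> v \<and> b i \<noteq> v" "[0..<m]"]
          by (simp add: candidates_def)
        fix t3 s3
        assume t3: "t3 \<le> 40 * m * m + 59 * m + 19"
          and sol: "sol_array m s3 (greedy a b (candidates a b m (Gs ! h) e v))"
          and s3: "same_outside greedy_regs {aLabel, aColour, aSol} s2 s3"
        have "input_ok a b m s3" using ok s1 s2 s3 by (auto simp: input_ok_def same_outside_def)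
        moreover have "sol_array m s3 ?N" using sol by (simp add: neighbour_def)
        moreover have "children s3 = children s"
          using s1 s2 s3 by (auto simp: fun_eq_iff children_def same_outside_def)
        then have "trie_state s3 ns"
          using tr s1 s2 s3 by (auto simp: trie_state_def same_outside_def)
        ultimately show "quiet trie_insert (\<lambda>t''. quiet (If (Equal rNew rOne) enqueue skip)
          (\<lambda>t'''. Q (t1 + (t2 + (t3 + (t'' + t''')))))) s3"
        proof (rule quiet_trie_insert)
          fix t4 s4 ns'
          assume t4: "t4 \<le> 12 * m + 4" and tr': "trie_state s4 ns'"
            and ns': "set ns' = set ns \<union> (\<lambda>j. take j (bits m ?N)) ` {..m}"
            and new: "reg s4 rNew = of_bool (bits m ?N \<notin> set ns)"
            and s4: "same_outside trie_regs {aOne, aZero} s3 s4"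
          have paths: "{xs \<in> set ns'. length xs = m} = insert (bits m ?N) (bits m ` set Gs)"
            using full_paths_insert[OF ns'] ns by simp
          have ok4: "input_ok a b m s4"
            using ok s1 s2 s3 s4 by (auto simp: input_ok_def same_outside_def)
          have q4: "queue_state m Gs s4"
            using q s1 s2 s3 s4 by (auto simp: queue_state_def same_outside_def)
          have sol4: "sol_array m s4 ?N"
            using \<open>sol_array m s3 ?N\<close> s4 by (auto simp: sol_array_def same_outside_def)
          have one: "reg s4 rOne = 1" using ok4 by (simp add: input_ok_def)
          \<comment> \<open>The parts add up to \<open>40 * m * m + 92 * m + 34\<close>; the bound
            is generous.\<close>
          have time: "t1 + (t2 + (t3 + (t4 + t))) \<le> 120 * (m + 1) ^ 2" if "t \<le> 5 * m + 4" for t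
            using t1 t2 t3 t4 that by (simp add: power2_eq_square algebra_simps)
          show "quiet (If (Equal rNew rOne) enqueue skip)
            (\<lambda>t. Q (t1 + (t2 + (t3 + (t4 + t))))) s4"
          proof (cases "?N \<in> set Gs")
            case True
            have "search_state a b m Gs s4"
              using ok4 q4 dist sols tr' paths True unfolding search_state_def by auto
            then have "search_state a b m Gs (s4\<lparr>reg := (reg s4)(rJunk := 0)\<rparr>)"
              by (rule search_state_same[where R = "{rJunk}" and A = "{}"])
                (auto simp: same_outside_def)
            then have "Q (t1 + (t2 + (t3 + (t4 + Suc 1)))) (s4\<lparr>reg := (reg s4)(rJunk := 0)\<rparr>)"
              using True s1 s2 s3 s4
              by (intro Q time) (auto simp: same_outside_def)
            then show ?thesis using True known new one by (simp add: skip_def)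
          next
            case False
            have "quiet enqueue (\<lambda>t. Q (t1 + (t2 + (t3 + (t4 + Suc t))))) s4"
            proof (rule quiet_enqueue_queue[OF ok4 sol4 q4])
              fix t5 s5
              assume t5: "t5 \<le> 5 * m + 3" and q5: "queue_state m (Gs @ [?N]) s5"
                and s5: "same_outside {rI, rS, rTailPtr, rTail} {aQueue} s4 s5"
              have "children s5 = children s4"
                using s5 by (auto simp: fun_eq_iff children_def same_outside_def)
              then have "trie_state s5 ns'" using tr' s5 by (auto simp: trie_state_def same_outside_def)
              moreover have "input_ok a b m s5" using ok4 s5 by (auto simp: input_ok_def same_outside_def)
              ultimately have "search_state a b m (Gs @ [?N]) s5"
                using q5 dist False sols N paths unfolding search_state_def by auto
              then show "Q (t1 + (t2 + (t3 + (t4 + Suc t5)))) s5"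
                using s1 s2 s3 s4 s5 t5
                by (intro Q time) (auto simp: same_outside_def)
            qed
            then show ?thesis using False known new one by simp
          qed
        qed
      qed
    qed
  qed
qed

lemma wregs_process: "wregs process \<subseteq> process_regs" and warrs_process: "warrs process \<subseteq> process_arrs"
  by (auto simp: process_def start_cands_def append_cand_def append_all_def run_greedy_def
    init_labels_def init_vertex_def add_edge_def relabel_def relabel_vertex_def trie_insert_def
    enqueue_def skip_def)

text \<open>Solutions are appended while the expansion is still running. The expanded one keeps its
  position \<open>h\<close>, so every intermediate queue \<open>Gs @ xs\<close> yields the same
  neighbours.\<close>

lemma quiet_process_all:
  assumes st: "search_state a b m Gs s" and h: "h < length Gs" "reg s rHeadPtr = h * m"
    and Q: "\<And>t s' xs. t \<le> 250 * (m + 1) ^ 3 \<Longrightarrow> search_state a b m (Gs @ xs) s' \<Longrightarrow>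
      (\<And>e v. e < m \<Longrightarrow> v \<in> {a e, b e} \<Longrightarrow> neighbour a b m (Gs ! h) e v \<in> set (Gs @ xs)) \<Longrightarrow>
      same_outside (insert rE (insert rV process_regs)) process_arrs s s' \<Longrightarrow> Q t s'"
  shows "quiet process_all Q s"
proof -
  let ?T = "120 * (m + 1) ^ 2"
  let ?N = "\<lambda>e v. neighbour a b m (Gs ! h) e v"
  let ?R = "insert rE (insert rV process_regs)"
  have ok: "input_ok a b m s" using st by (simp add: search_state_def)
  have step: "quiet (Do (Load rV x rE) ;; process) P s'"
    if st': "search_state a b m (Gs @ xs) s'" and s': "same_outside ?R process_arrs s s'"
      and e: "reg s' rE = e" "e < m" and x: "x \<in> {0, 1}"
      and P: "\<And>t s'' ys. t \<le> ?T + 1 \<Longrightarrow> search_state a b m (Gs @ xs @ ys) s'' \<Longrightarrow>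
        ?N e (arr s x e) \<in> set (Gs @ xs @ ys) \<Longrightarrow>
        same_outside (?R - {rE}) process_arrs s' s'' \<Longrightarrow> P t s''" for s' xs e x P
  proof -
    let ?s = "s'\<lparr>reg := (reg s')(rV := arr s x e)\<rparr>"
    have arr: "arr s' x = arr s x" using s' x by (auto simp: same_outside_def)
    have "quiet process (\<lambda>t. P (1 + t)) ?s"
    proof (rule quiet_process[where Gs = "Gs @ xs" and h = h and e = e and v = "arr s x e"])
      show "search_state a b m (Gs @ xs) ?s"
        by (rule search_state_same[OF st', where R = "{rV}" and A = "{}"])
          (auto simp: same_outside_def)
      show "reg ?s rHeadPtr = h * m" using h s' by (simp add: same_outside_def)
      fix t s'' Gs'
      assume t: "t \<le> ?T" and *: "search_state a b m Gs' s''"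
        "Gs' = Gs @ xs \<or> Gs' = (Gs @ xs) @ [neighbour a b m ((Gs @ xs) ! h) e (arr s x e)]"
        "neighbour a b m ((Gs @ xs) ! h) e (arr s x e) \<in> set Gs'"
        "same_outside process_regs process_arrs ?s s''"
      then obtain ys where "Gs' = Gs @ xs @ ys" by auto
      then show "P (1 + t) s''"
        using t * h by (intro P[of _ ys]) (auto simp: nth_append same_outside_def)
    qed (use h e in auto)
    then show ?thesis using e arr by simp
  qed
  let ?I = "\<lambda>k s'. \<exists>xs. search_state a b m (Gs @ xs) s' \<and>
      (\<forall>e<k. \<forall>v\<in>{a e, b e}. ?N e v \<in> set (Gs @ xs))"
  have upd: "search_state a b m Hs (s'\<lparr>reg := (reg s')(rE := k)\<rparr>)"
    if "search_state a b m Hs s'" for Hs s' k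
    by (rule search_state_same[OF that, where R = "{rE}" and A = "{}"]) (auto simp: same_outside_def)
  show ?thesis
    unfolding process_all_def
  proof (rule quiet_For[where I = ?I and T = "2 * ?T + 2" and R = ?R and A = process_arrs],
      goal_cases)
    case 1
    show ?case using upd[OF st] by (intro exI[of _ "[]"]) simp
  next
    case (8 k s')
    then obtain xs where st': "search_state a b m (Gs @ xs) s'"
      and before: "\<forall>e<k. \<forall>v\<in>{a e, b e}. ?N e v \<in> set (Gs @ xs)" by blast
    have k: "k < m" using 8 ok by (simp add: input_ok_def)
    \<comment> \<open>The body is rebracketed into one half per endpoint, so that
      \<open>step\<close> applies to each half.\<close>
    have "quiet ((Do (Load rV 0 rE) ;; process) ;; (Do (Load rV 1 rE) ;; process))
        (\<lambda>t s''. t \<le> 2 * ?T + 2 \<and> ?I (Suc k) (s''\<lparr>reg := (reg s'')(rE := Suc k)\<rparr>)) s'"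
      unfolding quiet_Seq[of "Do (Load rV 0 rE) ;; process"]
    proof (rule step[OF st' 8(4,3) k])
      fix t1 s1 ys
      assume t1: "t1 \<le> ?T + 1" and st1: "search_state a b m (Gs @ xs @ ys) s1"
        and n1: "?N k (arr s 0 k) \<in> set (Gs @ xs @ ys)"
        and s1: "same_outside (?R - {rE}) process_arrs s' s1"
      have s1': "same_outside ?R process_arrs s s1" using s1 8(4) by (auto simp: same_outside_def)
      have e1: "reg s1 rE = k" using s1 8(3) by (simp add: same_outside_def)
      show "quiet (Do (Load rV 1 rE) ;; process)
        (\<lambda>t' s''. t1 + t' \<le> 2 * ?T + 2 \<and> ?I (Suc k) (s''\<lparr>reg := (reg s'')(rE := Suc k)\<rparr>)) s1"
      proof (rule step[OF st1 s1' e1 k])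
        fix t2 s2 zs
        assume t2: "t2 \<le> ?T + 1" and st2: "search_state a b m (Gs @ (xs @ ys) @ zs) s2"
          and n2: "?N k (arr s 1 k) \<in> set (Gs @ (xs @ ys) @ zs)"
        have "\<forall>e<Suc k. \<forall>v\<in>{a e, b e}. ?N e v \<in> set (Gs @ xs @ ys @ zs)"
          using before n1 n2 ok by (auto simp: less_Suc_eq input_ok_def)
        then have "?I (Suc k) (s2\<lparr>reg := (reg s2)(rE := Suc k)\<rparr>)"
          using upd[OF st2] by (intro exI[of _ "xs @ ys @ zs"]) simp
        moreover have "t1 + t2 \<le> 2 * ?T + 2" using t1 t2 by linarith
        ultimately show "t1 + t2 \<le> 2 * ?T + 2 \<and> ?I (Suc k) (s2\<lparr>reg := (reg s2)(rE := Suc k)\<rparr>)"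
          by (rule conjI[rotated])
      qed simp
    qed simp
    then show ?case by (simp add: add.assoc)
  next
    case (9 t s')
    then obtain xs where "search_state a b m (Gs @ xs) s'"
      "\<forall>e<m. \<forall>v\<in>{a e, b e}. ?N e v \<in> set (Gs @ xs)"
      using ok by (auto simp: input_ok_def)
    \<comment> \<open>The loop costs \<open>m * (2 * ?T + 4) + 2\<close>, whose leading term
      \<open>240 * m ^ 3\<close> explains the constant.\<close>
    moreover have "t \<le> 250 * (m + 1) ^ 3"
      using 9(1) ok by (simp add: input_ok_def power2_eq_square power3_eq_cube algebra_simps)
    ultimately show ?case using 9(4) by (intro Q[of _ xs]) auto
  qed (use ok wregs_process warrs_process in \<open>auto simp: input_ok_def\<close>)
qed

section \<open>Delay and output\<close>

text \<open>\<open>k\<close> is the time elapsed since the last completed solution.\<close>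

fun paced :: "nat \<Rightarrow> nat \<Rightarrow> event list \<Rightarrow> bool" where
  "paced D k [] \<longleftrightarrow> k \<le> D"
| "paced D k (e # es) \<longleftrightarrow>
     (if e = Completed then Suc k \<le> D \<and> paced D 0 es else paced D (Suc k) es)"

lemma paced_append:
  "Completed \<notin> set xs \<Longrightarrow> paced D k (xs @ ys) \<longleftrightarrow> paced D (k + length xs) ys"
  by (induction xs arbitrary: k) auto

lemma output_times_Nil [simp]: "output_times [] = []"
  by (simp add: output_times_def)

lemma output_times_Cons [simp]:
  "output_times (e # es) = (if e = Completed then [1] else []) @ map Suc (output_times es)"
proof -
  have "[0..<length (e # es)] = 0 # map Suc [0..<length es]"
    by (simp add: upt_conv_Cons map_Suc_upt del: upt_Suc)
  then show ?thesis by (simp add: output_times_def filter_map o_def)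
qed

text \<open>All times are shifted by the \<open>k\<close> units already waited, which lets a suffix
  of the run be treated on its own. After a mark the induction restarts at 0, and a common shift
  does not affect differences.\<close>

lemma paced_gap:
  "paced D k es \<Longrightarrow> ts = 0 # map (\<lambda>t. t + k) (output_times es @ [length es]) \<Longrightarrow>
     Suc i < length ts \<Longrightarrow> ts ! Suc i - ts ! i \<le> D"
proof (induction es arbitrary: k ts i)
  case Nil
  then show ?case by simp
next
  case (Cons e es)
  show ?case
  proof (cases "e = Completed")
    case True
    let ?us = "0 # map (\<lambda>t. t + 0) (output_times es @ [length es])"
    have ts: "ts = 0 # map (\<lambda>t. t + Suc k) ?us"
      using Cons.prems(2) True by simp
    show ?thesis
    proof (cases i)
      case 0
      then show ?thesis using Cons.prems(1) True ts by simp
    next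
      case (Suc j)
      then have "Suc j < length ?us" using Cons.prems(3) ts by simp
      then show ?thesis
        using Cons.IH[of 0 ?us j] Cons.prems(1) True Suc ts
        by (simp del: list.map)
    qed
  next
    case False
    then show ?thesis using Cons.IH[of "Suc k" ts i] Cons.prems by (simp add: o_def)
  qed
qed

lemma delay_le: "paced D 0 evs \<Longrightarrow> delay evs \<le> D"
proof -
  assume paced: "paced D 0 evs"
  define ts where "ts = 0 # output_times evs @ [length evs]"
  let ?S = "{ts ! Suc i - ts ! i | i. Suc i < length ts}"
  have S: "?S = (\<lambda>i. ts ! Suc i - ts ! i) ` {i. Suc i < length ts}" by auto
  have "finite {i. Suc i < length ts}" by (rule finite_subset[of _ "{..<length ts}"]) auto
  then have "finite ?S" unfolding S by (rule finite_imageI)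
  moreover have "?S \<noteq> {}" unfolding S by (auto simp: ts_def)
  moreover have "x \<le> D" if "x \<in> ?S" for x
    using that paced_gap[OF paced, of ts] by (auto simp: ts_def)
  ultimately have "Max ?S \<le> D" by (rule Max.boundedI)
  then show ?thesis by (simp add: delay_def ts_def)
qed

text \<open>The counterpart of \<open>quiet\<close> for code that writes; the length of the event
  list takes the place of the time.\<close>

definition emits :: "com \<Rightarrow> (event list \<Rightarrow> state \<Rightarrow> bool) \<Rightarrow> state \<Rightarrow> bool" where
  "emits c Q s \<longleftrightarrow> (\<exists>tr s'. exec c s tr s' \<and> Q (map fst tr) s')"

lemma emits_mono: "emits c Q s \<Longrightarrow> (\<And>evs s'. Q evs s' \<Longrightarrow> R evs s') \<Longrightarrow> emits c R s"
  unfolding emits_def by blast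

lemma emits_Do [simp]: "emits (Do i) Q s \<longleftrightarrow> Q [visible i s] (effect i s)"
  unfolding emits_def by (auto elim!: exec_DoE intro!: exI exec.Do)

lemma emits_Seq [simp]:
  "emits (c ;; d) Q s \<longleftrightarrow> emits c (\<lambda>evs s'. emits d (\<lambda>evs' s''. Q (evs @ evs') s'') s') s"
proof
  assume "emits (c ;; d) Q s"
  then show "emits c (\<lambda>evs s'. emits d (\<lambda>evs' s''. Q (evs @ evs') s'') s') s"
    unfolding emits_def by (fastforce elim!: exec_SeqE)
next
  assume "emits c (\<lambda>evs s'. emits d (\<lambda>evs' s''. Q (evs @ evs') s'') s') s"
  then show "emits (c ;; d) Q s"
    unfolding emits_def by (elim exE conjE) (intro exI conjI, erule (1) exec.Seq, simp)
qed

lemma emits_If [simp]: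
  "emits (If b c d) Q s \<longleftrightarrow>
     (if holds b s then emits c (\<lambda>evs. Q (Silent # evs)) s
      else emits d (\<lambda>evs. Q (Silent # evs)) s)" (is "?l \<longleftrightarrow> ?r")
proof
  assume ?l
  then show ?r unfolding emits_def by (fastforce elim!: exec_IfE)
next
  assume r: ?r
  show ?l
  proof (cases "holds b s")
    case True
    with r obtain tr s' where "exec c s tr s'" "Q (Silent # map fst tr) s'"
      unfolding emits_def by auto
    with exec.IfTrue[OF True this(1), of d] show ?thesis
      unfolding emits_def by (intro exI conjI) auto
  next
    case False
    with r obtain tr s' where "exec d s tr s'" "Q (Silent # map fst tr) s'"
      unfolding emits_def by auto
    with exec.IfFalse[OF False this(1), of c] show ?thesis
      unfolding emits_def by (intro exI conjI) auto
  qed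
qed

lemma emits_skip [simp]: "emits skip Q s \<longleftrightarrow> Q [Silent] (s\<lparr>reg := (reg s)(rJunk := 0)\<rparr>)"
  by (simp add: skip_def)

lemma emits_WhileFalse: "\<not> holds b s \<Longrightarrow> Q [Silent] s \<Longrightarrow> emits (While b c) Q s"
  unfolding emits_def by (intro exI conjI, erule exec.WhileFalse) simp

lemma emits_WhileTrue:
  assumes b: "holds b s"
    and c: "emits c (\<lambda>evs s'. emits (While b c) (\<lambda>evs' s''. Q (Silent # evs @ evs') s'') s') s"
  shows "emits (While b c) Q s"
proof -
  obtain tr s' tr' s'' where *: "exec c s tr s'" "exec (While b c) s' tr' s''"
    "Q (Silent # map fst tr @ map fst tr') s''"
    using c unfolding emits_def by blast
  from exec.WhileTrue[OF b *(1,2)] *(3) show ?thesis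
    unfolding emits_def by (intro exI conjI) auto
qed

lemma quiet_emits:
  assumes "quiet c (\<lambda>t s'. \<forall>evs. length evs = t \<longrightarrow> set evs \<subseteq> {Silent} \<longrightarrow> Q evs s') s"
  shows "emits c Q s"
proof -
  obtain tr s' where tr: "exec c s tr s'" "\<forall>x\<in>set tr. fst x = Silent"
    and Q: "\<forall>evs. length evs = length tr \<longrightarrow> set evs \<subseteq> {Silent} \<longrightarrow> Q evs s'"
    using assms unfolding quiet_def by blast
  have "Q (map fst tr) s'" using Q[rule_format, of "map fst tr"] tr by auto
  with tr(1) show ?thesis unfolding emits_def by blast
qed

definition sol_list :: "nat \<Rightarrow> nat set \<Rightarrow> nat list" where
  "sol_list m G = filter (\<lambda>i. i \<in> G) [0..<m]"

abbreviation (input) "loud \<equiv> filter (\<lambda>e. e \<noteq> Silent)"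

text \<open>\<open>quiet_For\<close> does not apply to a body that writes, so the unfolded loop is
  handled by induction on the remaining edges. A round takes six units: test, load, branch, write or
  \<open>skip\<close>, and two increments.\<close>

lemma emits_output_loop:
  assumes "reg s rM = m" "reg s rOne = 1" "reg s rI = k" "k \<le> m" "reg s rPtr = p + k"
    "\<And>i. i < m \<Longrightarrow> arr s aQueue (p + i) = of_bool (i \<in> G)"
  shows "emits (While (Less rI rM)
      ((Do (Load rS aQueue rPtr) ;; If (Equal rS rOne) (Do (Write rI)) skip ;;
       Do (Add rPtr rPtr rOne)) ;; Do (Add rI rI rOne)))
    (\<lambda>evs s'. length evs \<le> 6 * (m - k) + 1 \<and> Completed \<notin> set evs \<and>
       loud evs = map Wrote (filter (\<lambda>i. i \<in> G) [k..<m]) \<and>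
       same_outside {rI, rS, rPtr, rJunk} {} s s') s"
  using assms
proof (induction "m - k" arbitrary: k s)
  case 0
  then show ?case by (intro emits_WhileFalse) (auto simp: same_outside_def)
next
  case (Suc d)
  let ?loop = "While (Less rI rM)
      ((Do (Load rS aQueue rPtr) ;; If (Equal rS rOne) (Do (Write rI)) skip ;;
       Do (Add rPtr rPtr rOne)) ;; Do (Add rI rI rOne))"
  have k: "k < m" using Suc.hyps by simp
  have IH: "emits ?loop P s'"
    if "same_outside {rI, rS, rPtr, rJunk} {} s s'" "reg s' rI = Suc k" "reg s' rPtr = Suc (p + k)"
      "\<And>evs s''. length evs \<le> 6 * (m - Suc k) + 1 \<Longrightarrow> Completed \<notin> set evs \<Longrightarrow>
        loud evs = map Wrote (filter (\<lambda>i. i \<in> G) [Suc k..<m]) \<Longrightarrow>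
        same_outside {rI, rS, rPtr, rJunk} {} s s'' \<Longrightarrow> P evs s''" for s' P
  proof (rule emits_mono[OF Suc.hyps(1)[of "Suc k" s']])
    show "d = m - Suc k" "Suc k \<le> m" using Suc.hyps k by auto
    fix evs s''
    assume "length evs \<le> 6 * (m - Suc k) + 1 \<and> Completed \<notin> set evs \<and>
       loud evs = map Wrote (filter (\<lambda>i. i \<in> G) [Suc k..<m]) \<and>
       same_outside {rI, rS, rPtr, rJunk} {} s' s''"
    then show "P evs s''" using that(1) by (intro that(4)) (auto simp: same_outside_def)
  qed (use that Suc.prems in \<open>auto simp: same_outside_def\<close>)
  have upt: "[k..<m] = k # [Suc k..<m]" using k by (rule upt_conv_Cons)
  have bit: "arr s aQueue (p + k) = of_bool (k \<in> G)" using Suc.prems(6)[OF k] .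
  show ?case
  proof (rule emits_WhileTrue)
    show "holds (Less rI rM) s" using Suc.prems k by simp
    show "emits ((Do (Load rS aQueue rPtr) ;; If (Equal rS rOne) (Do (Write rI)) skip ;;
       Do (Add rPtr rPtr rOne)) ;; Do (Add rI rI rOne)) (\<lambda>evs s'. emits ?loop
         (\<lambda>evs' s''. length (Silent # evs @ evs') \<le> 6 * (m - k) + 1 \<and>
           Completed \<notin> set (Silent # evs @ evs') \<and>
           loud (Silent # evs @ evs') = map Wrote (filter (\<lambda>i. i \<in> G) [k..<m]) \<and>
           same_outside {rI, rS, rPtr, rJunk} {} s s'') s') s"
    proof (cases "k \<in> G")
      case True
      then show ?thesis
        using Suc.prems bit
        by (simp, intro IH) (use k in \<open>auto simp: same_outside_def upt\<close>)
    next
      case False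
      then show ?thesis
        using Suc.prems bit
        by (simp, intro IH)
          (use k in \<open>auto simp: same_outside_def upt\<close>)
    qed
  qed
qed

lemma emits_output_sol:
  assumes ok: "input_ok a b m s" and G: "G \<subseteq> {..<m}"
    and queue: "\<And>i. i < m \<Longrightarrow> arr s aQueue (reg s rHeadPtr + i) = of_bool (i \<in> G)"
    and Q: "\<And>evs s'. length evs \<le> 6 * m + 3 \<Longrightarrow> Completed \<notin> set evs \<Longrightarrow>
      loud evs = map Wrote (sol_list m G) \<Longrightarrow>
      same_outside {rI, rS, rPtr, rJunk} {} s s' \<Longrightarrow> Q (evs @ [Completed]) s'"
  shows "emits output_sol Q s"
proof -
  let ?s = "s\<lparr>reg := (reg s)(rPtr := reg s rHeadPtr, rI := 0)\<rparr>"
  note loop = emits_output_loop[of ?s m 0 "reg s rHeadPtr" G]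
  have "emits (While (Less rI rM)
      ((Do (Load rS aQueue rPtr) ;; If (Equal rS rOne) (Do (Write rI)) skip ;;
       Do (Add rPtr rPtr rOne)) ;; Do (Add rI rI rOne)))
    (\<lambda>evs s'. Q (Silent # Silent # evs @ [Completed]) s') ?s"
  proof (rule emits_mono[OF loop])
    fix evs s'
    assume "length evs \<le> 6 * (m - 0) + 1 \<and> Completed \<notin> set evs \<and>
       loud evs = map Wrote (filter (\<lambda>i. i \<in> G) [0..<m]) \<and>
       same_outside {rI, rS, rPtr, rJunk} {} ?s s'"
    then show "Q (Silent # Silent # evs @ [Completed]) s'"
      using Q[of "Silent # Silent # evs" s'] by (auto simp: sol_list_def same_outside_def)
  qed (use ok queue in \<open>auto simp: input_ok_def\<close>)
  then show ?thesis by (simp add: output_sol_def For_def)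
qed

section \<open>The search loop and the complete run\<close>

definition written :: "nat \<Rightarrow> nat set \<Rightarrow> event list" where
  "written m G = map Wrote (sol_list m G) @ [Completed]"

lemma finite_maxbip: "finite {G. maxbip a b m G}"
  by (rule finite_subset[of _ "Pow {..<m}"]) (auto simp: maxbip_def)

text \<open>The measure counts the maximal sets not yet dequeued. Keeping the queue
  \<open>Gs\<close> a prefix of the final list \<open>Hs\<close> identifies the solution being
  written as entry \<open>h\<close> of it. Pacing is claimed for every waiting time \<open>k\<close>
  that an expansion can leave behind, so that the bound passes from one round to the next.\<close>

lemma emits_main_loop:
  assumes "search_state a b m Gs s" "reg s rHead = h" "reg s rHeadPtr = h * m" "h \<le> length Gs"
    and "\<And>k e v. k < h \<Longrightarrow> e < m \<Longrightarrow> v \<in> {a e, b e} \<Longrightarrow> neighbour a b m (Gs ! k) e v \<in> set Gs"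
    and "Gs \<noteq> []"
  shows "emits main_loop (\<lambda>evs s'. \<exists>Hs. distinct Hs \<and> set Hs = {G. maxbip a b m G} \<and>
      (\<exists>xs. Hs = Gs @ xs) \<and> loud evs = concat (map (written m) (drop h Hs)) \<and>
      (\<forall>k \<le> 252 * (m + 1) ^ 3. paced (260 * (m + 1) ^ 3) k evs)) s"
  using assms
proof (induction "card {G. maxbip a b m G} - h" arbitrary: Gs s h rule: less_induct)
  case less
  note st = less.prems(1) and h = less.prems(2-4) and closed = less.prems(5) and ne = less.prems(6)
  have ok: "input_ok a b m s" and q: "queue_state m Gs s" and dist: "distinct Gs"
    and sols: "\<And>G. G \<in> set Gs \<Longrightarrow> maxbip a b m G"
    using st by (auto simp: search_state_def)
  have pos: "1 \<le> (m + 1) ^ 3" "m + 1 \<le> (m + 1) ^ 3" by (simp_all add: self_le_power)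
  have tail: "reg s rTail = length Gs" using q by (simp add: queue_state_def)
  show ?case
  proof (cases "h = length Gs")
    case True
    \<comment> \<open>An empty queue means that every solution found has been expanded, so the found
      solutions are closed under neighbours.\<close>
    have "H \<in> set Gs" if "maxbip a b m H" for H
    proof (rule closed_family_complete[where \<G> = "set Gs"])
      show "maxbip a b m G" if "G \<in> set Gs" for G using sols that .
      show "neighbour a b m G e v \<in> set Gs" if "G \<in> set Gs" "e < m" "v \<in> {a e, b e}" for G e v
        using closed[of _ e v] that True by (auto simp: in_set_conv_nth)
      show "hd Gs \<in> set Gs" using ne by simp
      show "maxbip a b m H" by (rule that)
    qed
    then have "set Gs = {G. maxbip a b m G}" using sols by blast
    moreover have "paced (260 * (m + 1) ^ 3) k [Silent]" if "k \<le> 252 * (m + 1) ^ 3" for k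
    proof -
      have "Suc k \<le> 260 * (m + 1) ^ 3" using that pos(1) by linarith
      then show ?thesis by simp
    qed
    moreover have "\<not> holds (Less rHead rTail) s" using True h tail by simp
    ultimately show ?thesis
      unfolding main_loop_def using True dist by (intro emits_WhileFalse) auto
  next
    case False
    then have hl: "h < length Gs" using h by simp
    let ?body = "output_sol ;; process_all ;; Do (Add rHeadPtr rHeadPtr rM) ;; Do (Add rHead rHead rOne)"
    let ?G = "Gs ! h"
    have G: "?G \<subseteq> {..<m}" using sols hl by (auto simp: maxbip_def)
    have "length Gs \<le> card {G. maxbip a b m G}"
      using sols dist finite_maxbip by (metis card_mono distinct_card mem_Collect_eq subsetI)
    then have smaller: "card {G. maxbip a b m G} - Suc h < card {G. maxbip a b m G} - h"
      using hl by linarith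
    let ?post = "\<lambda>Gs h evs. \<exists>Hs. distinct Hs \<and> set Hs = {G. maxbip a b m G} \<and>
      (\<exists>xs. Hs = Gs @ xs) \<and> loud evs = concat (map (written m) (drop h Hs)) \<and>
      (\<forall>k \<le> 252 * (m + 1) ^ 3. paced (260 * (m + 1) ^ 3) k evs)"
    have "emits ?body (\<lambda>evs s'. emits main_loop (\<lambda>evs' s''. ?post Gs h (Silent # evs @ evs')) s') s"
      unfolding emits_Seq[of output_sol]
    proof (rule emits_output_sol[OF ok G])
      show "arr s aQueue (reg s rHeadPtr + i) = of_bool (i \<in> ?G)" if "i < m" for i
        using q hl h that by (simp add: queue_state_def)
      fix out s1
      assume out: "length out \<le> 6 * m + 3" "Completed \<notin> set out" "loud out = map Wrote (sol_list m ?G)"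
        and s1: "same_outside {rI, rS, rPtr, rJunk} {} s s1"
      have st1: "search_state a b m Gs s1" by (rule search_state_same[OF st s1]) auto
      have regs1: "reg s1 rHead = h" "reg s1 rHeadPtr = h * m" using h s1 by (simp_all add: same_outside_def)
      show "emits (process_all ;; Do (Add rHeadPtr rHeadPtr rM) ;; Do (Add rHead rHead rOne))
        (\<lambda>evs s'. emits main_loop
          (\<lambda>evs' s''. ?post Gs h (Silent # ((out @ [Completed]) @ evs) @ evs')) s') s1"
      proof (rule quiet_emits, unfold quiet_Seq, rule quiet_process_all[OF st1 hl regs1(2)])
        fix t s2 xs
        assume t: "t \<le> 250 * (m + 1) ^ 3" and st2: "search_state a b m (Gs @ xs) s2"
          and new: "\<And>e v. e < m \<Longrightarrow> v \<in> {a e, b e} \<Longrightarrow> neighbour a b m ?G e v \<in> set (Gs @ xs)"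
          and s2: "same_outside (insert rE (insert rV process_regs)) process_arrs s1 s2"
        have regs2: "reg s2 rHead = h" "reg s2 rHeadPtr = h * m" "reg s2 rM = m" "reg s2 rOne = 1"
          using s2 regs1 st2 by (simp_all add: same_outside_def search_state_def input_ok_def)
        let ?s = "s2\<lparr>reg := (reg s2)(rHeadPtr := Suc h * m, rHead := Suc h)\<rparr>"
        have st3: "search_state a b m (Gs @ xs) ?s"
          by (rule search_state_same[OF st2, where R = "{rHead, rHeadPtr}" and A = "{}"])
            (auto simp: same_outside_def)
        have rec: "emits main_loop (\<lambda>evs s'. ?post (Gs @ xs) (Suc h) evs) ?s"
        proof (rule less.hyps[OF smaller st3])
          show "Suc h \<le> length (Gs @ xs)" using hl by simp
          fix k e v assume k: "k < Suc h" and e: "e < m" "v \<in> {a e, b e}"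
          show "neighbour a b m ((Gs @ xs) ! k) e v \<in> set (Gs @ xs)"
          proof (cases "k = h")
            case True
            then show ?thesis using new[OF e] hl by (simp add: nth_append)
          next
            case False
            then show ?thesis using closed[of k e v] k e hl by (simp add: nth_append)
          qed
        qed (use ne in auto)
        have "emits main_loop (\<lambda>evs' s''. ?post Gs h (Silent # ((out @ [Completed]) @ evs) @ evs')) ?s"
          if evs: "length evs = t + 2" "set evs \<subseteq> {Silent}" for evs
        proof (rule emits_mono[OF rec])
          fix evs'
          assume "?post (Gs @ xs) (Suc h) evs'"
          then obtain Hs where Hs: "distinct Hs" "set Hs = {G. maxbip a b m G}" "\<exists>ys. Hs = (Gs @ xs) @ ys"
            "loud evs' = concat (map (written m) (drop (Suc h) Hs))"
            and paced: "\<And>k. k \<le> 252 * (m + 1) ^ 3 \<Longrightarrow> paced (260 * (m + 1) ^ 3) k evs'"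
            by blast
          have "loud evs = []" using evs(2) by (auto simp: filter_empty_conv)
          moreover have "drop h Hs = ?G # drop (Suc h) Hs"
            using Hs(3) hl by (auto simp: Cons_nth_drop_Suc[symmetric] nth_append)
          ultimately have "loud (Silent # ((out @ [Completed]) @ evs) @ evs') =
              concat (map (written m) (drop h Hs))"
            using out(3) Hs(4) by (simp add: written_def)
          moreover have "paced (260 * (m + 1) ^ 3) k (Silent # ((out @ [Completed]) @ evs) @ evs')"
            if k: "k \<le> 252 * (m + 1) ^ 3" for k
          proof -
            have "Completed \<notin> set evs" using evs(2) by auto
            \<comment> \<open>The increase from 250 to 252 pays for the two pointer updates after
              the expansion.\<close>
            moreover have "t + 2 \<le> 252 * (m + 1) ^ 3" using t pos(1) by linarith
            \<comment> \<open>On top of \<open>k\<close> come the loop test, at most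
              \<open>6 * m + 3\<close> units of writing and the mark; the increase from 252 to 260
              covers them.\<close>
            moreover have "Suc (Suc k + length out) \<le> 260 * (m + 1) ^ 3"
              using k out(1) pos by linarith
            ultimately show ?thesis
              using out(2) evs(1) paced[of "t + 2"] by (simp add: paced_append)
          qed
          ultimately show "?post Gs h (Silent # ((out @ [Completed]) @ evs) @ evs')"
            using Hs(1-3) by (intro exI[of _ Hs]) auto
        qed
        then show "quiet (Do (Add rHeadPtr rHeadPtr rM)) (\<lambda>t' s'. quiet (Do (Add rHead rHead rOne))
          (\<lambda>t'' s''. \<forall>evs. length evs = t + (t' + t'') \<longrightarrow> set evs \<subseteq> {Silent} \<longrightarrow>
            emits main_loop (\<lambda>evs' s''. ?post Gs h (Silent # ((out @ [Completed]) @ evs) @ evs')) s'') s') s2"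
          using regs2 by (simp add: add.commute)
      qed
    qed
    moreover have "holds (Less rHead rTail) s" using hl h tail by simp
    ultimately show ?thesis unfolding main_loop_def by (intro emits_WhileTrue)
  qed
qed

lemma emits_program:
  assumes regs: "reg s = (\<lambda>_. 0)(0 := m, 1 := n)" and arrs: "arr s = (\<lambda>_ _. 0)(0 := a, 1 := b)"
  shows "emits program (\<lambda>evs s'. \<exists>Hs. distinct Hs \<and> set Hs = {G. maxbip a b m G} \<and>
      loud evs = concat (map (written m) Hs) \<and> paced (260 * (m + 1) ^ 3) 0 evs) s"
proof -
  let ?post = "\<lambda>evs. \<exists>Hs. distinct Hs \<and> set Hs = {G. maxbip a b m G} \<and>
      loud evs = concat (map (written m) Hs) \<and> paced (260 * (m + 1) ^ 3) 0 evs"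
  let ?s = "s\<lparr>reg := (reg s)(rOne := 1, rNodes := 1)\<rparr>"
  let ?G = "greedy a b [0..<m]"
  have G: "maxbip a b m ?G" by (rule greedy_maxbip) auto
  have init: "quiet (append_all ;; run_greedy ;; trie_insert ;; enqueue)
    (\<lambda>t s'. \<forall>evs. length evs = 2 + t \<longrightarrow> set evs \<subseteq> {Silent} \<longrightarrow>
      emits main_loop (\<lambda>evs'. \<lambda>_. ?post (evs @ evs')) s') ?s"
    unfolding quiet_Seq
  proof (rule quiet_append_all)
    show "input_ok a b m ?s" using regs arrs by (simp add: input_ok_def)
    fix t1 s1
    assume t1: "t1 \<le> 4 * m + 2" and c1: "cands s1 = cands ?s @ [0..<m]"
      and s1: "same_outside {rI, rLen} {aCand} ?s s1"
    have "input_ok a b m s1" using regs arrs s1 by (simp add: input_ok_def same_outside_def)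
    moreover have "cands s1 = [0..<m]" using c1 regs by (simp add: cands_def)
    ultimately show "quiet run_greedy (\<lambda>t. quiet trie_insert (\<lambda>t'. quiet enqueue
      (\<lambda>t'' s'. \<forall>evs. length evs = 2 + (t1 + (t + (t' + t''))) \<longrightarrow> set evs \<subseteq> {Silent} \<longrightarrow>
        emits main_loop (\<lambda>evs'. \<lambda>_. ?post (evs @ evs')) s'))) s1"
    proof (rule quiet_run_greedy)
      fix t2 s2
      assume t2: "t2 \<le> 40 * m * m + 59 * m + 19" and sol2: "sol_array m s2 ?G"
        and s2: "same_outside greedy_regs {aLabel, aColour, aSol} s1 s2"
      have ok2: "input_ok a b m s2" using regs arrs s1 s2 by (simp add: input_ok_def same_outside_def)
      have "children s2 = (\<lambda>_ _. 0)"
        using arrs s1 s2 by (auto simp: children_def same_outside_def fun_eq_iff)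
      moreover have "reg s2 rNodes = 1" using s1 s2 by (simp add: same_outside_def)
      \<comment> \<open>Zeroed child cells together with \<open>rNodes = 1\<close> already encode
        the trie that has only a root.\<close>
      ultimately have "trie_state s2 [[]]" by (auto simp: trie_state_def trie_def)
      with ok2 sol2 show "quiet trie_insert (\<lambda>t'. quiet enqueue
        (\<lambda>t'' s'. \<forall>evs. length evs = 2 + (t1 + (t2 + (t' + t''))) \<longrightarrow> set evs \<subseteq> {Silent} \<longrightarrow>
          emits main_loop (\<lambda>evs'. \<lambda>_. ?post (evs @ evs')) s')) s2"
      proof (rule quiet_trie_insert)
        fix t3 s3 ns
        assume t3: "t3 \<le> 12 * m + 4" and tr3: "trie_state s3 ns"
          and ns: "set ns = set [[]] \<union> (\<lambda>j. take j (bits m ?G)) ` {..m}"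
          and s3: "same_outside trie_regs {aOne, aZero} s2 s3"
        \<comment> \<open>For \<open>m = 0\<close> the root itself has full length, but it is then
          the word of \<open>?G\<close>.\<close>
        have paths: "{xs \<in> set ns. length xs = m} = {bits m ?G}"
          using full_paths_insert[OF ns] by (auto simp: bits_def)
        have ok3: "input_ok a b m s3" using ok2 s3 by (simp add: input_ok_def same_outside_def)
        have sol3: "sol_array m s3 ?G" using sol2 s3 by (simp add: sol_array_def same_outside_def)
        have regs3: "reg s3 rTail = 0" "reg s3 rTailPtr = 0" "reg s3 rHead = 0" "reg s3 rHeadPtr = 0"
          using regs s1 s2 s3 by (simp_all add: same_outside_def)
        have "queue_state m [] s3" using regs3 by (simp add: queue_state_def)
        with ok3 sol3 show "quiet enqueue
          (\<lambda>t'' s'. \<forall>evs. length evs = 2 + (t1 + (t2 + (t3 + t''))) \<longrightarrow> set evs \<subseteq> {Silent} \<longrightarrow>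
            emits main_loop (\<lambda>evs'. \<lambda>_. ?post (evs @ evs')) s') s3"
        proof (rule quiet_enqueue_queue, intro allI impI)
          fix t4 s4 and evs :: "event list"
          assume t4: "t4 \<le> 5 * m + 3" and q4: "queue_state m ([] @ [?G]) s4"
            and s4: "same_outside {rI, rS, rTailPtr, rTail} {aQueue} s3 s4"
            and evs: "length evs = 2 + (t1 + (t2 + (t3 + t4)))" "set evs \<subseteq> {Silent}"
          have "children s4 = children s3"
            using s4 by (auto simp: fun_eq_iff children_def same_outside_def)
          then have "trie_state s4 ns" using tr3 s4 by (simp add: trie_state_def same_outside_def)
          moreover have "input_ok a b m s4" using ok3 s4 by (simp add: input_ok_def same_outside_def)
          ultimately have st: "search_state a b m [?G] s4"
            using q4 G paths unfolding search_state_def by auto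
          \<comment> \<open>The preparation fits into the waiting time allowed after an expansion,
            so the first output needs no separate bound.\<close>
          have "length evs \<le> 252 * (m + 1) ^ 2"
            using t1 t2 t3 t4 evs by (simp add: power2_eq_square algebra_simps)
          also have "\<dots> \<le> 252 * (m + 1) ^ 3" by (simp add: power_increasing)
          finally have len: "length evs \<le> 252 * (m + 1) ^ 3" .
          have silent: "Completed \<notin> set evs" "loud evs = []"
            using evs(2) by (auto simp: filter_empty_conv)
          show "emits main_loop (\<lambda>evs'. \<lambda>_. ?post (evs @ evs')) s4"
            by (rule emits_mono[OF emits_main_loop[OF st, of 0]])
              (use s4 regs3 len silent in \<open>auto simp: same_outside_def paced_append\<close>)
        qed
      qed
    qed auto
  qed
  have "quiet (Do (Const rOne 1) ;; Do (Const rNodes 1) ;; append_all ;; run_greedy ;;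
      trie_insert ;; enqueue)
    (\<lambda>t s'. \<forall>evs. length evs = t \<longrightarrow> set evs \<subseteq> {Silent} \<longrightarrow>
      emits main_loop (\<lambda>evs'. \<lambda>_. ?post (evs @ evs')) s') s"
    using init by simp
  then show ?thesis
    unfolding program_def emits_Seq[of _ main_loop] by (rule quiet_emits)
qed

lemma represents_card: "represents ps E \<Longrightarrow> card E = length ps"
  unfolding represents_def by (metis distinct_card length_map)

lemma input_bounded:
  assumes "simple_graph {0..<n} E" "represents ps E"
  shows "bounded_state (length ps) (length ps + n) (input_state n ps)"
proof -
  have "fst (ps ! i) < n \<and> snd (ps ! i) < n" if "i < length ps" for i
  proof -
    have "edge_of (ps ! i) \<in> E" using assms(2) that by (auto simp: represents_def)
    then have "edge_of (ps ! i) \<subseteq> {0..<n}" using assms(1) by (simp add: simple_graph_def)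
    then show ?thesis by (simp add: edge_of_def)
  qed
  then have "fst (ps ! i) \<le> length ps + n" "snd (ps ! i) \<le> length ps + n" if "i < length ps" for i
    using that by (simp_all add: trans_le_add2 less_imp_le)
  then show ?thesis
    by (auto simp: bounded_state_def input_state_def)
qed

theorem theorem5p8:
  "\<exists>(P :: com) (K :: nat) (c :: nat) (d :: nat).
     \<forall>(n :: nat) (E :: nat set set) (ps :: (nat \<times> nat) list).
       simple_graph {0..<n} E \<longrightarrow> represents ps E \<longrightarrow>
       (\<exists>tr s' xss.
          exec P (input_state n ps) tr s' \<and>
          word_bounded c d (n + card E) tr \<and>
          writes_solutions (map fst tr) xss \<and>
          lists_exactly_once ps xss {F. maximal_edge_bipartite E F} \<and>
          delay (map fst tr) \<le> K * (card E ^ 3 + 1))"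
proof (rule exI[of _ program], rule exI[of _ 2080], rule exI[of _ 1], rule exI[of _ 2],
    intro allI impI)
  fix n E and ps :: "(nat \<times> nat) list"
  assume graph: "simple_graph {0..<n} E" and rep: "represents ps E"
  let ?m = "length ps" and ?s = "input_state n ps"
  define a b where "a = arr ?s 0" and "b = arr ?s 1"
  have ab: "a i = fst (ps ! i) \<and> b i = snd (ps ! i)" if "i < length ps" for i
    using that by (simp add: a_def b_def input_state_def)
  have card: "card E = ?m" using rep by (rule represents_card)
  have "reg ?s = (\<lambda>_. 0)(0 := ?m, 1 := n)" "arr ?s = (\<lambda>_ _. 0)(0 := a, 1 := b)"
    by (auto simp: input_state_def a_def b_def)
  from emits_program[OF this] obtain tr s' Hs where tr: "exec program ?s tr s'"
    and Hs: "distinct Hs" "set Hs = {G. maxbip a b ?m G}"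
    and out: "loud (map fst tr) = concat (map (written ?m) Hs)"
    and paced: "paced (260 * (?m + 1) ^ 3) 0 (map fst tr)"
    unfolding emits_def by blast
  let ?xss = "map (sol_list ?m) Hs"
  have sub: "G \<subseteq> {..<?m}" if "G \<in> set Hs" for G using that Hs by (simp add: maxbip_def)
  have set_sol: "set (sol_list ?m G) = G" if "G \<in> set Hs" for G
    using sub[OF that] by (auto simp: sol_list_def)
  let ?e = "\<lambda>i. edge_of (ps ! i)"
  have edges: "map (edges_at ps) ?xss = map ((`) ?e) Hs"
    using set_sol by (simp add: edges_at_def)
  have inj: "inj_on ?e {..<?m}" by (rule inj_edge[OF rep ab refl])
  have "inj_on ((`) ?e) (set Hs)"
    by (rule inj_on_subset[OF inj_on_image_Pow[OF inj]]) (intro subsetI PowI sub)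
  moreover have "{F. maximal_edge_bipartite E F} = (`) ?e ` {G. maxbip a b ?m G}"
    by (rule maximal_edge_bipartite_sets[OF rep ab refl])
  ultimately have "lists_exactly_once ps ?xss {F. maximal_edge_bipartite E F}"
    unfolding lists_exactly_once_def edges
    using Hs by (auto simp: distinct_map sol_list_def)
  moreover have "writes_solutions (map fst tr) ?xss"
    using out by (simp add: writes_solutions_def written_def[abs_def] o_def)
  moreover have "word_bounded 1 2 (n + card E) tr"
    unfolding card by (rule tame_word_bounded[OF tr tame_program input_bounded[OF graph rep]])
  moreover have "delay (map fst tr) \<le> 2080 * (card E ^ 3 + 1)"
  proof -
    \<comment> \<open>The factor 8 comes from \<open>?m + 1 \<le> 2 * ?m\<close> for nonempty
      graphs, and \<open>2080 = 8 * 260\<close>. The summand 1 is what bounds the constant running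
      time on the empty graph.\<close>
    have "(?m + 1) ^ 3 \<le> 8 * (?m ^ 3 + 1)"
    proof (cases "?m = 0")
      case False
      then have "?m + 1 \<le> 2 * ?m" by linarith
      then have "(?m + 1) ^ 3 \<le> (2 * ?m) ^ 3" by (rule power_mono) simp
      then show ?thesis by (simp add: power_mult_distrib)
    qed simp
    then show ?thesis using delay_le[OF paced] unfolding card by linarith
  qed
  ultimately show "\<exists>tr s' xss. exec program ?s tr s' \<and> word_bounded 1 2 (n + card E) tr \<and>
      writes_solutions (map fst tr) xss \<and>
      lists_exactly_once ps xss {F. maximal_edge_bipartite E F} \<and>
      delay (map fst tr) \<le> 2080 * (card E ^ 3 + 1)"
    using tr by blast
qed

end
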